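(* Let $R$ be a commutative ring, let $\delta\in R$ be invertible in $R$, and let $n\geq 0$. Then the inclusion and projection maps $R\mathfrak S_n\xrightarrow{\iota}\mathcal P_n(R,\delta)\xrightarrow{\pi}R\mathfrak S_n$ induce mutually inverse isomorphisms \[ \mathrm{Tor}_\ast^{R\mathfrak S_n}(\mathbb 1,\mathbb 1)\xrightarrow[\cong]{\ \iota_\ast\ }\mathrm{Tor}_\ast^{\mathcal P_n(R,\delta)}(\mathbb 1,\mathbb 1)\xrightarrow[\cong]{\ \pi_\ast\ }\mathrm{Tor}_\ast^{R\mathfrak S_n}(\mathbb 1,\mathbb 1). \] In particular $\mathrm{Tor}_\ast^{\mathcal P_n(R,\delta)}(\mathbb 1,\mathbb 1)\cong H_\ast(\mathfrak S_n;\mathbb 1)$.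
   Context: For a commutative ring $R$, an element $\delta\in R$ and $n\geq 0$, the partition algebra $\mathcal P_n=\mathcal P_n(R,\delta)$ is the free $R$-module with basis the set partitions ("diagrams") of $\{-n,\dots,-1,1,\dots,n\}$; the negative elements are "left nodes" and the positive ones "right nodes". The product of diagrams $d_1d_2$ is obtained by identifying the right nodes of $d_1$ with the corresponding left nodes of $d_2$ (these become "middle" nodes), forming the induced partition on the remaining left nodes of $d_1$ and right nodes of $d_2$ by connectivity, and multiplying by $\delta^c$ where $c$ is the number of connected components consisting only of middle nodes; extend bilinearly. A permutation diagram is one in which every block has the form $\{-i,j\}$; these form a copy of $\mathfrak S_n$, giving the inclusion $\iota\colon R\mathfrak S_n\to\mathcal P_n$, and $\pi\colon\mathcal P_n\to R\mathfrak S_n$ is the $R$-linear map sending permutation diagrams to the corresponding permutations and all other diagrams to $0$ (an algebra map with $\pi\iota=\mathrm{id}$). The trivial module $\mathbb 1$ of $R\mathfrak S_n$ is $R$ with every permutation acting as the identity (on both sides); the trivial module $\mathbb 1$ of $\mathcal P_n$ is $R$ with permutation diagrams acting as the identity and all other diagrams acting as $0$ (on both sides), i.e. the pullback along $\pi$. $H_\ast(\mathfrak S_n;\mathbb 1)=\mathrm{Tor}_\ast^{R\mathfrak S_n}(\mathbb 1,\mathbb 1)$. *)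

theory Defs
  imports Main "HOL-Library.Disjoint_Sets"
begin

text \<open>Nodes: -n..-1 are the left nodes, 1..n the right nodes.\<close>
definition nodes :: "nat \<Rightarrow> int set" where
  "nodes n = {- int n .. -1} \<union> {1 .. int n}"

text \<open>Diagrams = set partitions of the node set (the R-basis of P_n).\<close>
definition diagrams :: "nat \<Rightarrow> int set set set" where
  "diagrams n = {d. partition_on (nodes n) d}"

definition is_perm_block :: "int set \<Rightarrow> bool" where
  "is_perm_block B \<longleftrightarrow> (\<exists>i j::int. 0 < i \<and> 0 < j \<and> B = {-i, j})"

text \<open>Permutation diagrams: the copy of S_n inside P_n (basis of R S_n).\<close>
definition perm_diagrams :: "nat \<Rightarrow> int set set set" where
  "perm_diagrams n = {d \<in> diagrams n. \<forall>B\<in>d. is_perm_block B}"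

text \<open>Stacking d1 on top of d2: left nodes of d1 become (0,i), right nodes of d1
  and left nodes of d2 are identified as middle nodes (1,j), right nodes of d2
  become (2,j).\<close>
definition lift1 :: "int \<Rightarrow> int \<times> int" where
  "lift1 i = (if i < 0 then (0, i) else (1, i))"

definition lift2 :: "int \<Rightarrow> int \<times> int" where
  "lift2 i = (if i < 0 then (1, - i) else (2, i))"

definition stack_rel :: "int set set \<Rightarrow> int set set \<Rightarrow> ((int \<times> int) \<times> (int \<times> int)) set" where
  "stack_rel d1 d2 = {(x, y). (\<exists>B\<in>d1. x \<in> lift1 ` B \<and> y \<in> lift1 ` B)
                           \<or> (\<exists>B\<in>d2. x \<in> lift2 ` B \<and> y \<in> lift2 ` B)}"

definition stack_comps :: "int set set \<Rightarrow> int set set \<Rightarrow> (int \<times> int) set set" where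
  "stack_comps d1 d2 = Field (stack_rel d1 d2) // trancl (stack_rel d1 d2)"

definition outer :: "(int \<times> int) set" where
  "outer = {p. fst p \<noteq> 1}"

definition diag_comp :: "int set set \<Rightarrow> int set set \<Rightarrow> int set set" where
  "diag_comp d1 d2 = {snd ` (C \<inter> outer) | C. C \<in> stack_comps d1 d2 \<and> C \<inter> outer \<noteq> {}}"

text \<open>Number of components consisting only of middle nodes; d1 d2 = delta^c (diag_comp d1 d2).\<close>
definition closed_loops :: "int set set \<Rightarrow> int set set \<Rightarrow> nat" where
  "closed_loops d1 d2 = card {C \<in> stack_comps d1 d2. C \<inter> outer = {}}"

text \<open>Augmentation = action on the trivial module: 1 on permutation diagrams, 0 otherwise.
  (On R S_n every basis element is a permutation, so this is the trivial module of R S_n too.)\<close>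
definition eps :: "int set set \<Rightarrow> 'r::comm_ring_1" where
  "eps d = (if \<forall>B\<in>d. is_perm_block B then 1 else 0)"

section \<open>Bar complex computing Tor^A(1,1) for A = R S_n or A = P_n\<close>

text \<open>Degree-k chains: A^{\<otimes>k} (tensor over R), the free R-module on k-tuples of
  basis diagrams in B, represented as finitely supported coefficient functions.\<close>
definition bar_chains :: "int set set set \<Rightarrow> nat \<Rightarrow> (int set set list \<Rightarrow> 'r::comm_ring_1) set" where
  "bar_chains B k = {c. \<forall>xs. c xs \<noteq> 0 \<longrightarrow> length xs = k \<and> set xs \<subseteq> B}"

definition single :: "'a \<Rightarrow> 'r \<Rightarrow> 'a \<Rightarrow> 'r::zero" where
  "single a r = (\<lambda>b. if b = a then r else 0)"

definition bar_face :: "'r::comm_ring_1 \<Rightarrow> int set set list \<Rightarrow> nat \<Rightarrow> int set set list \<Rightarrow> 'r" where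
  "bar_face \<delta> xs i =
     (if i = 0 then single (tl xs) (eps (hd xs))
      else if i = length xs then single (butlast xs) (eps (last xs))
      else single (take (i - 1) xs @ [diag_comp (xs ! (i - 1)) (xs ! i)] @ drop (i + 1) xs)
                  (\<delta> ^ closed_loops (xs ! (i - 1)) (xs ! i)))"

definition bar_d_basis :: "'r::comm_ring_1 \<Rightarrow> int set set list \<Rightarrow> int set set list \<Rightarrow> 'r" where
  "bar_d_basis \<delta> xs = (\<lambda>ys. if xs = [] then 0
      else (\<Sum>i\<in>{0 .. length xs}. (-1) ^ i * bar_face \<delta> xs i ys))"

definition bar_d :: "'r::comm_ring_1 \<Rightarrow> (int set set list \<Rightarrow> 'r) \<Rightarrow> (int set set list \<Rightarrow> 'r)" where
  "bar_d \<delta> c = (\<lambda>ys. \<Sum>xs\<in>{xs. c xs \<noteq> 0}. c xs * bar_d_basis \<delta> xs ys)"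

definition bar_cycles :: "'r::comm_ring_1 \<Rightarrow> int set set set \<Rightarrow> nat \<Rightarrow> (int set set list \<Rightarrow> 'r) set" where
  "bar_cycles \<delta> B k = {c \<in> bar_chains B k. bar_d \<delta> c = (\<lambda>_. 0)}"

definition bar_boundaries :: "'r::comm_ring_1 \<Rightarrow> int set set set \<Rightarrow> nat \<Rightarrow> (int set set list \<Rightarrow> 'r) set" where
  "bar_boundaries \<delta> B k = bar_d \<delta> ` bar_chains B (Suc k)"

text \<open>iota^{\<otimes>k}: inclusion (coefficients unchanged); pi^{\<otimes>k}: kill every tuple
  containing a non-permutation diagram.\<close>
definition bar_iota :: "(int set set list \<Rightarrow> 'r) \<Rightarrow> (int set set list \<Rightarrow> 'r)" where
  "bar_iota c = c"

definition bar_pi :: "nat \<Rightarrow> (int set set list \<Rightarrow> 'r::zero) \<Rightarrow> (int set set list \<Rightarrow> 'r)" where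
  "bar_pi n c = (\<lambda>xs. if set xs \<subseteq> perm_diagrams n then c xs else 0)"

end

theory Submission
  imports Defs
begin

text \<open>The kernel of the projection on bar complexes is spanned by the tuples that contain a
  non-permutation diagram, and it has to be shown that this subcomplex is acyclic.

  Two-colourings of the nodes that are constant on blocks turn a diagram $d$ into a 0/1-matrix
  $M_d$ indexed by subsets of $\{1,\dots,n\}$, and $M_{d_1} M_{d_2} = 2^c M_{d_1 d_2}$, where $c$
  counts the closed loops. Since $d$ is determined by $M_d$, associativity of matrix multiplication
  gives associativity of the diagram product together with the cocycle identity for loops.

  For a non-permutation diagram $y$, let $e_y$ be the diagram that cuts the strands at the right
  singletons of $y$ and joins the strands that lie in a common block on the right of $y$. As
  $\delta$ is invertible, a power of it makes $e_y$ idempotent, and the left ideal it generates is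
  the span of those diagrams whose right pattern is at least as coarse as that of $y$. Tuples ending
  in this ideal form an acyclic complex, because appending $e_y$ is a contraction. Any intersection
  of such ideals is a union of such ideals, so Mayer-Vietoris shows that tuples ending in a
  non-permutation diagram form an acyclic complex. Filtering by the number of trailing permutations
  reduces the whole kernel to this case.\<close>

section \<open>Boolean colourings and the diagram product\<close>

text \<open>Projection after inclusion is the identity already on chains, so the content lies in the
  other composite: for a cycle z, projection minus identity yields a cycle of the kernel, and this
  must bound. One contraction does not suffice. In general no single non-permutation diagram e
  satisfies z e = \<delta>^u z for all non-permutation z, as different right patterns need different
  idempotents; hence the cover by cells. Left ideals are the suitable notion because the last tensor
  factor of the bar complex is only ever multiplied from the left, or dropped with coefficient 0.
  The exponent u is the number of right singletons: each cut strand of the idempotent meets a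
  singleton of z and closes one loop. This is where \<delta> has to be inverted. The colouring count
  takes place in the natural numbers, whatever R and \<delta> are: each closed loop carries one free
  binary choice, and the all-coloured entry, equal to 1 for every diagram, lets the number of loops
  be read off from a power of 2.\<close>

abbreviation pos :: "nat \<Rightarrow> int set" where
  "pos n \<equiv> {1 .. int n}"

text \<open>A two-colouring of the nodes is stored as one colour class. Left nodes are named by
  their absolute values, so that row and column indices of the matrix of a diagram range over the
  same set \<open>Pow (pos n)\<close> and matrices can be multiplied.\<close>

definition colouring :: "int set \<Rightarrow> int set \<Rightarrow> int set" where
  "colouring L R = uminus ` L \<union> R"

text \<open>This is the (L, R) entry of the 0/1-matrix of \<open>d\<close>.\<close>

definition compat :: "int set set \<Rightarrow> int set \<Rightarrow> int set \<Rightarrow> bool" where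
  "compat d L R \<longleftrightarrow> (\<forall>B\<in>d. B \<subseteq> colouring L R \<or> B \<inter> colouring L R = {})"

definition stack_nodes :: "nat \<Rightarrow> (int \<times> int) set" where
  "stack_nodes n = lift1 ` nodes n \<union> lift2 ` nodes n"

lemma finite_nodes: "finite (nodes n)"
  by (simp add: nodes_def)

lemma finite_diagrams: "finite (diagrams n)"
  unfolding diagrams_def using finite_nodes by (rule finitely_many_partition_on)

lemma nodes_eq: "nodes n = uminus ` pos n \<union> pos n"
  by (simp add: nodes_def)

lemma stack_nodes_eq: "stack_nodes n = Pair 0 ` uminus ` pos n \<union> Pair 1 ` pos n \<union> Pair 2 ` pos n"
proof -
  have "lift1 ` nodes n = Pair 0 ` uminus ` pos n \<union> Pair 1 ` pos n"
    unfolding nodes_eq image_Un image_image by (intro arg_cong2[where f = "(\<union>)"] image_cong) (auto simp: lift1_def)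
  moreover have "lift2 ` nodes n = Pair 1 ` pos n \<union> Pair 2 ` pos n"
    unfolding nodes_eq image_Un image_image by (intro arg_cong2[where f = "(\<union>)"] image_cong) (auto simp: lift2_def)
  ultimately show ?thesis by (simp add: stack_nodes_def Un_assoc Un_left_commute)
qed

section \<open>The graph of two stacked diagrams and its components\<close>

lemma stack_rel_iff:
  "(x, y) \<in> stack_rel d1 d2 \<longleftrightarrow>
    (\<exists>B\<in>d1. x \<in> lift1 ` B \<and> y \<in> lift1 ` B) \<or> (\<exists>B\<in>d2. x \<in> lift2 ` B \<and> y \<in> lift2 ` B)"
  by (simp add: stack_rel_def)

lemma sym_stack_rel: "sym (stack_rel d1 d2)"
  by (auto simp: sym_def stack_rel_iff)

lemma diagramsD:
  assumes "d \<in> diagrams n"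
  shows "\<Union>d = nodes n" "\<And>B C x. B \<in> d \<Longrightarrow> C \<in> d \<Longrightarrow> x \<in> B \<Longrightarrow> x \<in> C \<Longrightarrow> B = C" "{} \<notin> d"
  using assms by (auto simp: diagrams_def partition_on_def disjoint_def)

lemma Field_stack_rel:
  assumes "d1 \<in> diagrams n" "d2 \<in> diagrams n"
  shows "Field (stack_rel d1 d2) = stack_nodes n"
proof -
  have "Field (stack_rel d1 d2) = lift1 ` \<Union>d1 \<union> lift2 ` \<Union>d2"
    unfolding Field_def by (rule set_eqI, simp only: Un_iff Domain_iff Range_iff stack_rel_iff) blast
  then show ?thesis
    using assms by (simp add: diagramsD(1) stack_nodes_def)
qed

text \<open>The quotient in \<open>stack_comps\<close> uses \<open>trancl\<close> without a
  reflexive closure. Reflexivity on the field comes from symmetry: a step from x to y and back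
  relates x to itself.\<close>

lemma partition_on_stack_comps:
  assumes "d1 \<in> diagrams n" "d2 \<in> diagrams n"
  shows "partition_on (stack_nodes n) (stack_comps d1 d2)"
proof -
  let ?r = "stack_rel d1 d2"
  have "equiv (Field ?r) (?r\<^sup>+)"
  proof (rule equivI)
    show "sym (?r\<^sup>+)" by (simp add: sym_stack_rel sym_trancl)
    show "trans (?r\<^sup>+)" by simp
    show "refl_on (Field ?r) (?r\<^sup>+)"
    proof (rule refl_onI)
      fix x assume "x \<in> Field ?r"
      then obtain y where "(x, y) \<in> ?r" using symD[OF sym_stack_rel] unfolding Field_def by blast
      then show "(x, x) \<in> ?r\<^sup>+"
        by (meson r_into_trancl' sym_stack_rel symD trancl.trancl_into_trancl)
    qed
    show "?r\<^sup>+ \<subseteq> Field ?r \<times> Field ?r"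
      by (rule trancl_subset_Field2)
  qed
  then show ?thesis
    unfolding stack_comps_def Field_stack_rel[OF assms] by (rule partition_on_quotient)
qed

lemma finite_stack_comps:
  assumes "d1 \<in> diagrams n" "d2 \<in> diagrams n"
  shows "finite (stack_comps d1 d2)"
  using partition_on_stack_comps[OF assms]
  by (rule finite_elements[rotated]) (simp add: stack_nodes_def finite_nodes)

lemma stack_compsD:
  assumes "d1 \<in> diagrams n" "d2 \<in> diagrams n"
  shows "\<Union>(stack_comps d1 d2) = stack_nodes n"
    "\<And>B C x. B \<in> stack_comps d1 d2 \<Longrightarrow> C \<in> stack_comps d1 d2 \<Longrightarrow> x \<in> B \<Longrightarrow> x \<in> C \<Longrightarrow> B = C"
    "{} \<notin> stack_comps d1 d2"
  using partition_on_stack_comps[OF assms] by (auto simp: partition_on_def disjoint_def)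

text \<open>Outside the middle level the sign of the second coordinate determines the level, so
  forgetting the level in \<open>diag_comp\<close> loses nothing.\<close>

lemma inj_on_snd_outer: "inj_on snd (stack_nodes n \<inter> outer)"
  by (auto simp: inj_on_def stack_nodes_eq outer_def)

lemma snd_outer: "snd ` (stack_nodes n \<inter> outer) = nodes n"
  by (force simp: stack_nodes_eq outer_def nodes_def image_iff)

lemma diag_comp_diagrams:
  assumes "d1 \<in> diagrams n" "d2 \<in> diagrams n"
  shows "diag_comp d1 d2 \<in> diagrams n"
  unfolding diagrams_def mem_Collect_eq
proof (rule partition_onI)
  note cD = stack_compsD[OF assms]
  have "\<Union>(diag_comp d1 d2) = snd ` (\<Union>(stack_comps d1 d2) \<inter> outer)"
    unfolding diag_comp_def by blast
  then show "\<Union>(diag_comp d1 d2) = nodes n"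
    by (simp add: cD(1) snd_outer)
  show "{} \<notin> diag_comp d1 d2"
    by (auto simp: diag_comp_def)
  fix p q assume "p \<in> diag_comp d1 d2" "q \<in> diag_comp d1 d2" "p \<noteq> q"
  then obtain C D where CD: "C \<in> stack_comps d1 d2" "D \<in> stack_comps d1 d2"
     "p = snd ` (C \<inter> outer)" "q = snd ` (D \<inter> outer)" "C \<noteq> D"
    unfolding diag_comp_def by blast
  have "C \<inter> D = {}" using CD cD(2) by blast
  moreover have "C \<subseteq> stack_nodes n" "D \<subseteq> stack_nodes n" using CD cD(1) by blast+
  ultimately have "snd ` (C \<inter> outer) \<inter> snd ` (D \<inter> outer) = {}"
    using inj_on_image_Int[OF inj_on_snd_outer[of n], of "C \<inter> outer" "D \<inter> outer"] by blast
  then show "disjnt p q"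
    unfolding CD disjnt_def .
qed

section \<open>Counting colourings of the middle level\<close>

definition stack_colouring :: "int set \<Rightarrow> int set \<Rightarrow> int set \<Rightarrow> (int \<times> int) set" where
  "stack_colouring L H R = Pair 0 ` uminus ` L \<union> Pair 1 ` H \<union> Pair 2 ` R"

lemma lift1_in_stack_colouring:
  assumes "L \<subseteq> pos n" "H \<subseteq> pos n" "b \<in> nodes n"
  shows "lift1 b \<in> stack_colouring L H R \<longleftrightarrow> b \<in> colouring L H"
  using assms unfolding lift1_def stack_colouring_def colouring_def nodes_def by auto

lemma lift2_in_stack_colouring:
  assumes "H \<subseteq> pos n" "R \<subseteq> pos n" "b \<in> nodes n"
  shows "lift2 b \<in> stack_colouring L H R \<longleftrightarrow> b \<in> colouring H R"
proof -
  have "-b \<in> H \<longleftrightarrow> b \<in> uminus ` H" by (metis add.inverse_inverse image_eqI image_iff)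
  then show ?thesis
  using assms unfolding lift2_def stack_colouring_def colouring_def nodes_def by auto
qed

text \<open>A colouring is constant on a block exactly when one coloured node forces all others to
  be coloured; over the blocks of both factors this is closure under the stacking relation. The
  shared \<open>H\<close> makes the two colourings agree on identified nodes.\<close>

lemma compat_both_iff_closed:
  assumes d: "d1 \<in> diagrams n" "d2 \<in> diagrams n"
    and LR: "L \<subseteq> pos n" "H \<subseteq> pos n" "R \<subseteq> pos n"
  shows "compat d1 L H \<and> compat d2 H R \<longleftrightarrow>
    (\<forall>(x, y)\<in>stack_rel d1 d2. x \<in> stack_colouring L H R \<longrightarrow> y \<in> stack_colouring L H R)"
proof -
  have 1: "lift1 b \<in> stack_colouring L H R \<longleftrightarrow> b \<in> colouring L H" if "b \<in> B" "B \<in> d1" for b B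
    using that lift1_in_stack_colouring[of L n H b R] LR diagramsD(1)[OF d(1)] by blast
  have 2: "lift2 b \<in> stack_colouring L H R \<longleftrightarrow> b \<in> colouring H R" if "b \<in> B" "B \<in> d2" for b B
    using that lift2_in_stack_colouring[of H n R b L] LR diagramsD(1)[OF d(2)] by blast
  have "compat d1 L H \<longleftrightarrow> (\<forall>B\<in>d1. \<forall>a\<in>B. \<forall>b\<in>B. lift1 a \<in> stack_colouring L H R \<longrightarrow> lift1 b \<in> stack_colouring L H R)"
    unfolding compat_def using 1 by blast
  moreover have "compat d2 H R \<longleftrightarrow> (\<forall>B\<in>d2. \<forall>a\<in>B. \<forall>b\<in>B. lift2 a \<in> stack_colouring L H R \<longrightarrow> lift2 b \<in> stack_colouring L H R)"
    unfolding compat_def using 2 by blast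
  moreover have "(\<forall>(x, y)\<in>stack_rel d1 d2. x \<in> T \<longrightarrow> y \<in> T) \<longleftrightarrow>
      (\<forall>B\<in>d1. \<forall>a\<in>B. \<forall>b\<in>B. lift1 a \<in> T \<longrightarrow> lift1 b \<in> T) \<and>
      (\<forall>B\<in>d2. \<forall>a\<in>B. \<forall>b\<in>B. lift2 a \<in> T \<longrightarrow> lift2 b \<in> T)" for T
    unfolding stack_rel_def by blast
  ultimately show ?thesis
    by simp
qed

text \<open>A set closed under a symmetric relation is closed under its transitive closure in both
  directions, hence a union of classes.\<close>

lemma closed_iff_comps:
  assumes "T \<subseteq> Field (stack_rel d1 d2)"
  shows "(\<forall>(x, y)\<in>stack_rel d1 d2. x \<in> T \<longrightarrow> y \<in> T) \<longleftrightarrow>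
    (\<forall>C\<in>stack_comps d1 d2. C \<subseteq> T \<or> C \<inter> T = {})" (is "?l \<longleftrightarrow> ?r")
proof
  assume ?l
  have *: "y \<in> T" if "(x, y) \<in> (stack_rel d1 d2)\<^sup>+" "x \<in> T" for x y
    using that(1)
  proof (induction rule: trancl_induct)
    case (base y)
    with \<open>?l\<close> that(2) show ?case by auto
  next
    case (step y z)
    with \<open>?l\<close> show ?case by auto
  qed
  show ?r
  proof
    fix C assume "C \<in> stack_comps d1 d2"
    then obtain x where "C = (stack_rel d1 d2)\<^sup>+ `` {x}"
      unfolding stack_comps_def by (auto simp: quotient_def)
    moreover have "sym ((stack_rel d1 d2)\<^sup>+)" by (simp add: sym_stack_rel sym_trancl)
    ultimately show "C \<subseteq> T \<or> C \<inter> T = {}"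
      using * by (auto dest: symD)
  qed
next
  assume r: ?r
  show ?l
  proof clarify
    fix a b a' b' assume ab: "((a, b), (a', b')) \<in> stack_rel d1 d2" "(a, b) \<in> T"
    let ?C = "(stack_rel d1 d2)\<^sup>+ `` {(a, b)}"
    have "?C \<in> stack_comps d1 d2"
      unfolding stack_comps_def using ab by (intro quotientI) (auto simp: Field_def)
    moreover have "(a', b') \<in> ?C" using ab by auto
    moreover have "((a, b), (a, b)) \<in> (stack_rel d1 d2)\<^sup>+"
      using ab(1) sym_stack_rel by (meson r_into_trancl' symD trancl.trancl_into_trancl)
    then have "(a, b) \<in> ?C" by simp
    ultimately show "(a', b') \<in> T" using r ab(2) by blast
  qed
qed

lemma compat_both_iff_comps:
  assumes d: "d1 \<in> diagrams n" "d2 \<in> diagrams n"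
    and LR: "L \<subseteq> pos n" "H \<subseteq> pos n" "R \<subseteq> pos n"
  shows "compat d1 L H \<and> compat d2 H R \<longleftrightarrow>
    (\<forall>C\<in>stack_comps d1 d2. C \<subseteq> stack_colouring L H R \<or> C \<inter> stack_colouring L H R = {})"
  unfolding compat_both_iff_closed[OF assms]
  using LR by (intro closed_iff_comps) (auto simp: Field_stack_rel[OF d] stack_nodes_eq stack_colouring_def)

text \<open>Blocks of the product are traces of components on the outer nodes, and
  \<open>snd\<close> is injective there, so the condition can be pulled back to components. Closed
  loops have empty trace and satisfy it vacuously.\<close>

lemma compat_diag_comp_iff:
  assumes d: "d1 \<in> diagrams n" "d2 \<in> diagrams n"
    and LR: "L \<subseteq> pos n" "R \<subseteq> pos n"
  shows "compat (diag_comp d1 d2) L R \<longleftrightarrow>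
    (\<forall>C\<in>stack_comps d1 d2. C \<inter> outer \<subseteq> stack_colouring L {} R \<or> C \<inter> stack_colouring L {} R = {})"
proof -
  have sub: "stack_colouring L {} R \<subseteq> stack_nodes n \<inter> outer"
    using LR by (auto simp: stack_nodes_eq stack_colouring_def outer_def)
  have col: "colouring L R = snd ` stack_colouring L {} R"
    by (auto simp: colouring_def stack_colouring_def image_Un image_image)
  have img: "snd x \<in> colouring L R \<longleftrightarrow> x \<in> stack_colouring L {} R" if "x \<in> stack_nodes n \<inter> outer" for x
    unfolding col using that inj_on_image_mem_iff[OF inj_on_snd_outer _ sub] by blast
  have "(snd ` (C \<inter> outer) \<subseteq> colouring L R \<or> snd ` (C \<inter> outer) \<inter> colouring L R = {}) \<longleftrightarrow>
     (C \<inter> outer \<subseteq> stack_colouring L {} R \<or> C \<inter> stack_colouring L {} R = {})"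
    if "C \<in> stack_comps d1 d2" for C
  proof -
    have "C \<subseteq> stack_nodes n" using that stack_compsD(1)[OF d] by blast
    then show ?thesis using img sub by blast
  qed
  moreover have 0: "snd ` (C \<inter> outer) \<subseteq> colouring L R \<or> snd ` (C \<inter> outer) \<inter> colouring L R = {}"
    if "C \<inter> outer = {}" for C using that by simp
  have "compat (diag_comp d1 d2) L R \<longleftrightarrow>
     (\<forall>C\<in>stack_comps d1 d2. snd ` (C \<inter> outer) \<subseteq> colouring L R \<or> snd ` (C \<inter> outer) \<inter> colouring L R = {})"
    unfolding compat_def diag_comp_def using 0 by (simp only: Ball_def mem_Collect_eq) metis
  ultimately show ?thesis by simp
qed

text \<open>Entry (L, R) of the matrix product. The colour of a component that meets the outer nodes
  is forced by \<open>L\<close> and \<open>R\<close>, consistently exactly when the product diagram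
  is compatible with them; each closed loop may be coloured in two ways independently.\<close>

lemma card_compat_both:
  assumes d: "d1 \<in> diagrams n" "d2 \<in> diagrams n"
    and LR: "L \<subseteq> pos n" "R \<subseteq> pos n"
  shows "card {H \<in> Pow (pos n). compat d1 L H \<and> compat d2 H R} =
    (if compat (diag_comp d1 d2) L R then 2 ^ closed_loops d1 d2 else 0)"
proof -
  note cD = stack_compsD[OF d]
  let ?O = "stack_colouring L {} R" and ?T = "\<lambda>H. stack_colouring L H R"
  have T: "?T H = ?O \<union> Pair 1 ` H" for H by (auto simp: stack_colouring_def)
  have O: "?O \<subseteq> outer" "?O \<subseteq> stack_nodes n" and M: "Pair 1 ` H \<inter> outer = {}" for H :: "int set"
    using LR by (auto simp: stack_colouring_def outer_def stack_nodes_eq)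
  have X1: "h \<in> pos n" if "(1, h) \<in> stack_nodes n" for h
    using that by (auto simp: stack_nodes_eq)
  have X2: "\<exists>h\<in>pos n. x = (1, h)" if "x \<in> stack_nodes n" "x \<notin> outer" for x
    using that by (auto simp: stack_nodes_eq outer_def)
  have X3: "(1, h) \<in> stack_nodes n" if "h \<in> pos n" for h
    using that by (auto simp: stack_nodes_eq)
  let ?S = "{H \<in> Pow (pos n). compat d1 L H \<and> compat d2 H R}"
  let ?Cs = "stack_comps d1 d2"
  have S: "?S = {H \<in> Pow (pos n). \<forall>C\<in>?Cs. C \<subseteq> ?T H \<or> C \<inter> ?T H = {}}"
    using compat_both_iff_comps[OF d LR(1) _ LR(2)] by blast
  show ?thesis
  proof (cases "compat (diag_comp d1 d2) L R")
    case False
    have "?S = {}"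
    proof (rule ccontr)
      assume "?S \<noteq> {}"
      then obtain H where H: "\<forall>C\<in>?Cs. C \<subseteq> ?T H \<or> C \<inter> ?T H = {}" unfolding S by blast
      have "\<forall>C\<in>?Cs. C \<inter> outer \<subseteq> ?O \<or> C \<inter> ?O = {}"
      proof
        fix C assume "C \<in> ?Cs"
        with H have "C \<subseteq> ?T H \<or> C \<inter> ?T H = {}" by blast
        then show "C \<inter> outer \<subseteq> ?O \<or> C \<inter> ?O = {}" unfolding T[of H] using M[of H] by blast
      qed
      with False show False using compat_diag_comp_iff[OF d LR] by blast
    qed
    then show ?thesis using False by simp
  next
    case True
    then have c: "C \<inter> outer \<subseteq> ?O \<or> C \<inter> ?O = {}" if "C \<in> ?Cs" for C
      using that compat_diag_comp_iff[OF d LR] by blast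
    let ?loops = "{C \<in> ?Cs. C \<inter> outer = {}}"
    \<comment> \<open>The components forced to be coloured. Together with an arbitrary set
      \<open>D\<close> of loops they determine the middle colouring \<open>f D\<close>.\<close>
    define C0 where "C0 = {C \<in> ?Cs. C \<inter> ?O \<noteq> {}}"
    have C0: "C \<in> C0 \<longleftrightarrow> C \<in> ?Cs \<and> C \<inter> ?O \<noteq> {}" for C by (simp add: C0_def)
    define f where "f D = {h. (1, h) \<in> \<Union>(D \<union> C0)}" for D :: "(int \<times> int) set set"
    have Tf: "?T (f D) = \<Union>(D \<union> C0)" if D: "D \<subseteq> ?loops" for D
    proof
      have "?O \<subseteq> \<Union>C0" using O(2) cD(1) unfolding C0_def by blast
      moreover have "Pair 1 ` f D \<subseteq> \<Union>(D \<union> C0)" unfolding f_def by blast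
      ultimately show "?T (f D) \<subseteq> \<Union>(D \<union> C0)" unfolding T[of "f D"] Union_Un_distrib by (rule Un_least[OF le_supI2])
      show "\<Union>(D \<union> C0) \<subseteq> ?T (f D)"
      proof
        fix x assume x: "x \<in> \<Union>(D \<union> C0)"
        then have xX: "x \<in> stack_nodes n" using D cD(1) unfolding C0_def by blast
        show "x \<in> ?T (f D)"
        proof (cases "x \<in> outer")
          case True
          then have "x \<in> \<Union>C0" using x D by blast
          then have "x \<in> ?O" using True c unfolding C0_def by blast
          then show ?thesis unfolding T[of "f D"] by (rule UnI1)
        next
          case False
          then obtain h where "x = (1, h)" using X2 xX by blast
          then have "x \<in> Pair 1 ` f D" using x unfolding f_def by blast
          then show ?thesis unfolding T[of "f D"] by (rule UnI2)
        qed
      qed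
    qed
    \<comment> \<open>Surjectivity takes the loops contained in the stack colouring; injectivity
      holds because loops are nonempty and disjoint from each other and from the components in
      \<open>C0\<close>.\<close>
    have "bij_betw f (Pow ?loops) ?S"
      unfolding bij_betw_def
    proof (intro conjI set_eqI iffI)
      show "inj_on f (Pow ?loops)"
      proof (rule inj_onI)
        have *: "D \<subseteq> D'" if D: "D \<in> Pow ?loops" "D' \<in> Pow ?loops" "f D = f D'" for D D'
        proof
          fix C assume C: "C \<in> D"
          then have "C \<in> ?Cs" using D by blast
          then obtain x where x: "x \<in> C" using cD(3) by (metis all_not_in_conv)
          have "\<Union>(D \<union> C0) = \<Union>(D' \<union> C0)" using Tf[OF PowD[OF D(1)]] Tf[OF PowD[OF D(2)]] unfolding D(3) by simp
          moreover have "x \<in> \<Union>(D \<union> C0)" using C x by blast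
          ultimately obtain C' where C': "C' \<in> D' \<union> C0" "x \<in> C'" by (metis UnionE)
          have CC: "C \<in> ?Cs" "C \<inter> outer = {}" using C D(1) by blast+
          have "C' \<in> ?Cs" using C'(1) D(2) unfolding C0_def by blast
          then have "C = C'" using cD(2)[OF CC(1) _ x C'(2)] by simp
          moreover have "C \<inter> ?O = {}" using CC(2) O(1) by blast
          ultimately show "C \<in> D'" using C'(1) C0[of C] by simp
        qed
        show "D = D'" if "D \<in> Pow ?loops" "D' \<in> Pow ?loops" "f D = f D'" for D D'
          using *[OF that] *[OF that(2,1) that(3)[symmetric]] by blast
      qed
      fix H
      {
        assume "H \<in> f ` Pow ?loops"
        then obtain D where D: "D \<subseteq> ?loops" "H = f D" by blast
        have "C \<subseteq> ?T H \<or> C \<inter> ?T H = {}" if C: "C \<in> ?Cs" for C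
        proof (cases "C \<in> D \<union> C0")
          case True
          then show ?thesis unfolding D(2) Tf[OF D(1)] by blast
        next
          case False
          have "C \<inter> C' = {}" if C': "C' \<in> D \<union> C0" for C'
          proof -
            have "C' \<in> ?Cs" using C' D(1) C0 by blast
            moreover have "C \<noteq> C'" using C' False by blast
            ultimately show ?thesis using C cD(2) by blast
          qed
          then show ?thesis unfolding D(2) Tf[OF D(1)] by blast
        qed
        moreover have "H \<subseteq> pos n"
        proof
          fix h assume "h \<in> H"
          then have "(1, h) \<in> \<Union>?Cs" unfolding D(2) f_def C0_def using D(1) by blast
          then show "h \<in> pos n" unfolding cD(1) by (rule X1)
        qed
        ultimately show "H \<in> ?S" unfolding S by blast
      }
      assume "H \<in> ?S"
      then have H: "H \<subseteq> pos n" "C \<in> ?Cs \<Longrightarrow> C \<subseteq> ?T H \<or> C \<inter> ?T H = {}" for C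
        unfolding S by blast+
      let ?D = "{C \<in> ?loops. C \<subseteq> ?T H}"
      have "f ?D = H"
      proof
        show "f ?D \<subseteq> H"
        proof
          fix h assume "h \<in> f ?D"
          then obtain C where C: "C \<in> ?D \<union> C0" "(1, h) \<in> C" unfolding f_def by blast
          have "C \<subseteq> ?T H"
          proof (cases "C \<in> ?D")
            case False
            then have "C \<in> ?Cs" "C \<inter> ?O \<noteq> {}" using C C0 by blast+
            then show ?thesis using H(2)[of C] T[of H] by blast
          qed blast
          with C(2) show "h \<in> H" by (auto simp: stack_colouring_def)
        qed
        show "H \<subseteq> f ?D"
        proof
          fix h assume h: "h \<in> H"
          then have "(1, h) \<in> \<Union>?Cs" unfolding cD(1) using H(1) X3 by blast
          then obtain C where C: "C \<in> ?Cs" "(1, h) \<in> C" by blast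
          have "(1, h) \<in> ?T H" using h T by blast
          then have CT: "C \<subseteq> ?T H" using H(2)[OF C(1)] C(2) by blast
          have "C \<in> ?D \<union> C0"
          proof (cases "C \<inter> outer = {}")
            case True
            then show ?thesis using C(1) CT by blast
          next
            case False
            have "C \<inter> outer \<subseteq> ?O" using CT M[of H] unfolding T[of H] by blast
            then show ?thesis using False C(1) C0 by blast
          qed
          then show "h \<in> f ?D" unfolding f_def using C(2) by blast
        qed
      qed
      then show "H \<in> f ` Pow ?loops" by blast
    qed
    then have "card ?S = card (Pow ?loops)" by (simp add: bij_betw_same_card)
    also have "\<dots> = 2 ^ closed_loops d1 d2"
      unfolding closed_loops_def using finite_stack_comps[OF d] by (simp add: card_Pow)
    finally show ?thesis using True by simp
  qed
qed

section \<open>Recovering a diagram and its loop count from the matrix\<close>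

lemma compat_full: "d \<in> diagrams n \<Longrightarrow> compat d (pos n) (pos n)"
proof -
  have "nodes n \<subseteq> colouring (pos n) (pos n)"
  proof
    fix x assume "x \<in> nodes n"
    then have "x \<in> pos n \<or> - x \<in> pos n" by (auto simp: nodes_def)
    then show "x \<in> colouring (pos n) (pos n)"
      unfolding colouring_def by (metis UnI1 UnI2 add.inverse_inverse image_eqI)
  qed
  then show "d \<in> diagrams n \<Longrightarrow> compat d (pos n) (pos n)"
    using diagramsD(1)[of d n] by (auto simp: compat_def)
qed

lemma compat_empty: "compat d {} {}"
  by (simp add: compat_def colouring_def)

lemma compat_block:
  assumes "d \<in> diagrams n" "B \<in> d"
  obtains L R where "L \<subseteq> pos n" "R \<subseteq> pos n" "colouring L R = B" "compat d L R"
proof -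
  define L R where "L = {i \<in> pos n. - i \<in> B}" and "R = B \<inter> pos n"
  have "B \<subseteq> nodes n" using diagramsD(1)[OF assms(1)] assms(2) by blast
  moreover have "uminus ` L = B \<inter> uminus ` pos n"
  proof (rule set_eqI)
    fix x show "x \<in> uminus ` L \<longleftrightarrow> x \<in> B \<inter> uminus ` pos n"
      unfolding L_def by (auto intro!: image_eqI[of x uminus "- x"])
  qed
  ultimately have col: "colouring L R = B"
    unfolding colouring_def R_def nodes_eq by blast
  moreover have "compat d L R"
    unfolding compat_def col using diagramsD(2)[OF assms(1)] assms(2) by blast
  moreover have "L \<subseteq> pos n" "R \<subseteq> pos n" by (auto simp: L_def R_def)
  ultimately show ?thesis using that col by blast
qed

text \<open>Each block B of \<open>d\<close> is itself a colour class compatible with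
  \<open>d\<close>. As it is then compatible with \<open>d'\<close> as well, every block of
  \<open>d'\<close> meeting B lies inside B; by symmetry the blocks coincide.\<close>

lemma diagram_eqI:
  assumes d: "d \<in> diagrams n" "d' \<in> diagrams n"
    and eq: "\<And>L R. L \<subseteq> pos n \<Longrightarrow> R \<subseteq> pos n \<Longrightarrow> compat d L R \<longleftrightarrow> compat d' L R"
  shows "d = d'"
proof -
  have refine: "B' \<subseteq> B" if B: "B \<in> d" "B' \<in> d'" "x \<in> B" "x \<in> B'" and d: "d \<in> diagrams n" "d' \<in> diagrams n"
     and e: "\<And>L R. L \<subseteq> pos n \<Longrightarrow> R \<subseteq> pos n \<Longrightarrow> compat d L R \<longleftrightarrow> compat d' L R" for B B' x d d'
  proof -
    obtain L R where "L \<subseteq> pos n" "R \<subseteq> pos n" "colouring L R = B" "compat d L R"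
      using compat_block[OF d(1) B(1)] .
    then show ?thesis using B(2-4) e[of L R] unfolding compat_def by blast
  qed
  have sub: "d \<subseteq> d'" if d: "d \<in> diagrams n" "d' \<in> diagrams n"
     and e: "\<And>L R. L \<subseteq> pos n \<Longrightarrow> R \<subseteq> pos n \<Longrightarrow> compat d L R \<longleftrightarrow> compat d' L R" for d d'
  proof
    fix B assume B: "B \<in> d"
    then obtain x where x: "x \<in> B" using diagramsD(3)[OF d(1)] by (metis all_not_in_conv)
    then obtain B' where B': "B' \<in> d'" "x \<in> B'"
      using diagramsD(1)[OF d(1)] diagramsD(1)[OF d(2)] B by blast
    have "B' = B"
      using refine[OF B B'(1) x B'(2) d e] refine[OF B'(1) B B'(2) x d(2,1)] e by blast
    with B' show "B \<in> d'" by simp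
  qed
  show ?thesis using sub[OF d eq] sub[OF d(2,1)] eq by blast
qed

lemma sum_compat:
  assumes "d1 \<in> diagrams n" "d2 \<in> diagrams n" "L \<subseteq> pos n" "R \<subseteq> pos n"
  shows "(\<Sum>H\<in>Pow (pos n). of_bool (compat d1 L H) * of_bool (compat d2 H R)) =
    (2 ^ closed_loops d1 d2 * of_bool (compat (diag_comp d1 d2) L R) :: nat)"
proof -
  have "(\<Sum>H\<in>Pow (pos n). of_bool (compat d1 L H) * of_bool (compat d2 H R) :: nat) =
      (\<Sum>H\<in>Pow (pos n). of_bool (compat d1 L H \<and> compat d2 H R))"
    by (simp only: of_bool_conj)
  also have "\<dots> = card (Pow (pos n) \<inter> {H. compat d1 L H \<and> compat d2 H R})"
    by (subst sum_of_bool_eq) auto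
  also have "\<dots> = card {H \<in> Pow (pos n). compat d1 L H \<and> compat d2 H R}"
    by (simp only: Int_def mem_Collect_eq)
  finally show ?thesis using card_compat_both[OF assms] by simp
qed

lemma compat_diag_compE:
  assumes "d1 \<in> diagrams n" "d2 \<in> diagrams n" "L \<subseteq> pos n" "R \<subseteq> pos n" "compat (diag_comp d1 d2) L R"
  obtains H where "H \<subseteq> pos n" "compat d1 L H" "compat d2 H R"
proof -
  have "card {H \<in> Pow (pos n). compat d1 L H \<and> compat d2 H R} \<noteq> 0"
    using card_compat_both[OF assms(1-4)] assms(5) by simp
  then have "{H \<in> Pow (pos n). compat d1 L H \<and> compat d2 H R} \<noteq> {}" by (metis card.empty)
  then show ?thesis using that by blast
qed

lemma compat_diag_compI:
  assumes "d1 \<in> diagrams n" "d2 \<in> diagrams n" "L \<subseteq> pos n" "R \<subseteq> pos n" "H \<subseteq> pos n" "compat d1 L H" "compat d2 H R"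
  shows "compat (diag_comp d1 d2) L R"
proof (rule ccontr)
  assume "\<not> ?thesis"
  then have "card {H \<in> Pow (pos n). compat d1 L H \<and> compat d2 H R} = 0"
    using card_compat_both[OF assms(1-4)] by simp
  moreover have "finite {H \<in> Pow (pos n). compat d1 L H \<and> compat d2 H R}"
    by (rule finite_subset[of _ "Pow (pos n)"]) auto
  ultimately have "{H \<in> Pow (pos n). compat d1 L H \<and> compat d2 H R} = {}"
    by (simp only: card_0_eq)
  then show False using assms(5-7) by blast
qed

text \<open>The entry at the full colouring is 1 for both diagrams and yields 2^a = 2^b; the power
  then cancels at every other entry.\<close>

lemma loops_and_diagram_eqI:
  fixes a b :: nat
  assumes d: "d \<in> diagrams n" "d' \<in> diagrams n"
    and eq: "\<And>L R. L \<subseteq> pos n \<Longrightarrow> R \<subseteq> pos n \<Longrightarrow>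
      (2 ^ a * of_bool (compat d L R) :: nat) = 2 ^ b * of_bool (compat d' L R)"
  shows "a = b" "d = d'"
proof -
  show ab: "a = b" using eq[of "pos n" "pos n"] d by (simp add: compat_full)
  show "d = d'"
  proof (rule diagram_eqI[OF d])
    fix L R assume "L \<subseteq> pos n" "R \<subseteq> pos n"
    from eq[OF this] show "compat d L R \<longleftrightarrow> compat d' L R"
      unfolding ab by (cases "compat d L R"; cases "compat d' L R") auto
  qed
qed

text \<open>Both conclusions come from one matrix identity, which compares loop counts and diagrams
  at once without looking at components of a triple stack.\<close>

lemma diag_comp_assoc:
  assumes d: "d1 \<in> diagrams n" "d2 \<in> diagrams n" "d3 \<in> diagrams n"
  shows "closed_loops d1 d2 + closed_loops (diag_comp d1 d2) d3 =
      closed_loops d2 d3 + closed_loops d1 (diag_comp d2 d3)"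
    and "diag_comp (diag_comp d1 d2) d3 = diag_comp d1 (diag_comp d2 d3)"
proof -
  let ?P = "Pow (pos n)"
  define M where "M d L R = (of_bool (compat d L R) :: nat)" for d L R
  have sum_M: "(\<Sum>H\<in>?P. M d L H * M d' H R) = 2 ^ closed_loops d d' * M (diag_comp d d') L R"
    if "d \<in> diagrams n" "d' \<in> diagrams n" "L \<subseteq> pos n" "R \<subseteq> pos n" for d d' L R
    using sum_compat[OF that] unfolding M_def .
  note dc = diag_comp_diagrams[OF d(1,2)] diag_comp_diagrams[OF d(2,3)]
  have "2 ^ (closed_loops d1 d2 + closed_loops (diag_comp d1 d2) d3) *
         M (diag_comp (diag_comp d1 d2) d3) L R =
       2 ^ (closed_loops d2 d3 + closed_loops d1 (diag_comp d2 d3)) *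
         M (diag_comp d1 (diag_comp d2 d3)) L R"
    if LR: "L \<subseteq> pos n" "R \<subseteq> pos n" for L R
  proof -
    have "2 ^ (closed_loops d1 d2 + closed_loops (diag_comp d1 d2) d3) *
         M (diag_comp (diag_comp d1 d2) d3) L R =
        2 ^ closed_loops d1 d2 * (\<Sum>H\<in>?P. M (diag_comp d1 d2) L H * M d3 H R)"
      using sum_M[OF dc(1) d(3) LR] by (simp add: power_add)
    also have "\<dots> = (\<Sum>H\<in>?P. (\<Sum>G\<in>?P. M d1 L G * M d2 G H) * M d3 H R)"
      unfolding sum_distrib_left
      by (rule sum.cong[OF refl]) (simp add: sum_M[OF d(1,2) LR(1)])
    also have "\<dots> = (\<Sum>G\<in>?P. M d1 L G * (\<Sum>H\<in>?P. M d2 G H * M d3 H R))"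
      unfolding sum_distrib_left sum_distrib_right mult.assoc by (rule sum.swap)
    also have "\<dots> = 2 ^ closed_loops d2 d3 * (\<Sum>G\<in>?P. M d1 L G * M (diag_comp d2 d3) G R)"
      unfolding sum_distrib_left[of "2 ^ _"]
      by (rule sum.cong[OF refl]) (simp add: sum_M[OF d(2,3) _ LR(2)])
    also have "\<dots> = 2 ^ (closed_loops d2 d3 + closed_loops d1 (diag_comp d2 d3)) *
         M (diag_comp d1 (diag_comp d2 d3)) L R"
      using sum_M[OF d(1) dc(2) LR] by (simp add: power_add)
    finally show ?thesis .
  qed
  note eq = loops_and_diagram_eqI[OF diag_comp_diagrams[OF dc(1) d(3)] diag_comp_diagrams[OF d(1) dc(2)] this[unfolded M_def]]
  show "closed_loops d1 d2 + closed_loops (diag_comp d1 d2) d3 =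
      closed_loops d2 d3 + closed_loops d1 (diag_comp d2 d3)" by (rule eq(1))
  show "diag_comp (diag_comp d1 d2) d3 = diag_comp d1 (diag_comp d2 d3)" by (rule eq(2))
qed

section \<open>Permutation diagrams\<close>

lemma neg_in_colouring: "R \<subseteq> pos n \<Longrightarrow> i \<in> pos n \<Longrightarrow> - i \<in> colouring L R \<longleftrightarrow> i \<in> L"
  by (auto simp: colouring_def)

lemma pos_in_colouring: "L \<subseteq> pos n \<Longrightarrow> i \<in> pos n \<Longrightarrow> i \<in> colouring L R \<longleftrightarrow> i \<in> R"
  by (auto simp: colouring_def)

lemma nodes_cases:
  assumes "x \<in> nodes n"
  obtains i where "i \<in> pos n" "x = - i" | "x \<in> pos n"
  using assms unfolding nodes_eq by blast

lemma diagram_blockE: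
  assumes "d \<in> diagrams n" "x \<in> nodes n"
  obtains B where "B \<in> d" "x \<in> B"
  using diagramsD(1)[OF assms(1)] assms(2) by blast

lemma block_subset_nodes: "d \<in> diagrams n \<Longrightarrow> B \<in> d \<Longrightarrow> B \<subseteq> nodes n"
  using diagramsD(1) by blast

lemma compat_singleton_iff:
  assumes "d \<in> diagrams n" "L \<subseteq> pos n" "R \<subseteq> pos n" "colouring L R = {x}" "x \<in> nodes n"
  shows "compat d L R \<longleftrightarrow> {x} \<in> d"
proof
  assume c: "compat d L R"
  obtain B where B: "B \<in> d" "x \<in> B" using diagram_blockE[OF assms(1,5)] .
  with c have "B = {x}" unfolding compat_def assms(4) by blast
  with B show "{x} \<in> d" by simp
next
  assume "{x} \<in> d"
  then show "compat d L R"
    unfolding compat_def assms(4) using diagramsD(2)[OF assms(1)] by blast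
qed

text \<open>A pigeonhole argument: choosing a partner in \<open>A'\<close> for every element of
  \<open>A\<close> is injective, since a shared partner would put two elements of \<open>A\<close>
  into one block, hence surjective by cardinality. So every block meets \<open>A\<close> and
  contains nothing beyond one element and its partner. The two sides are abstract so that left and
  right nodes can take either role.\<close>

lemma partition_into_pairs:
  assumes "partition_on (A \<union> A') d" "finite A'" "card A' \<le> card A" "A \<inter> A' = {}"
    and one: "\<And>B a b. B \<in> d \<Longrightarrow> a \<in> A \<Longrightarrow> b \<in> A \<Longrightarrow> a \<in> B \<Longrightarrow> b \<in> B \<Longrightarrow> a = b"
    and meets: "\<And>B a. B \<in> d \<Longrightarrow> a \<in> A \<Longrightarrow> a \<in> B \<Longrightarrow> \<exists>b\<in>A'. b \<in> B"
    and B: "B \<in> d"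
  shows "\<exists>a\<in>A. \<exists>b\<in>A'. B = {a, b}"
proof -
  have U: "\<Union>d = A \<union> A'" and disj: "\<And>B C x. B \<in> d \<Longrightarrow> C \<in> d \<Longrightarrow> x \<in> B \<Longrightarrow> x \<in> C \<Longrightarrow> B = C"
    and ne: "{} \<notin> d"
    using assms(1) by (auto simp: partition_on_def disjoint_def)
  have "\<forall>a\<in>A. \<exists>b\<in>A'. \<exists>B\<in>d. a \<in> B \<and> b \<in> B"
    using meets U by (metis UnI1 UnionE)
  then obtain g where g: "\<forall>a\<in>A. g a \<in> A' \<and> (\<exists>B\<in>d. a \<in> B \<and> g a \<in> B)" by metis
  have "inj_on g A"
    by (rule inj_onI) (metis g disj one)
  moreover have "g ` A \<subseteq> A'" using g by blast
  ultimately have gA: "g ` A = A'"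
    using assms(2,3) by (metis card_image card_seteq)
  have "\<exists>a\<in>A. a \<in> B"
  proof -
    obtain x where x: "x \<in> B" using ne B by (metis all_not_in_conv)
    show ?thesis
    proof (cases "x \<in> A")
      case True with x show ?thesis by blast
    next
      case False
      then have "x \<in> A'" using x B U by blast
      then obtain a where a: "a \<in> A" "x = g a" using gA by blast
      then obtain C where "C \<in> d" "a \<in> C" "x \<in> C" using g by blast
      then show ?thesis using disj[OF B _ x] a by blast
    qed
  qed
  then obtain a where a: "a \<in> A" "a \<in> B" by blast
  have "g a \<in> B" using g a B disj by metis
  moreover have "y = a \<or> y = g a" if y: "y \<in> B" for y
  proof (cases "y \<in> A")
    case True then show ?thesis using one[OF B a(1) True a(2) y] by simp
  next
    case False
    then have "y \<in> A'" using y B U by blast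
    then obtain a' where a': "a' \<in> A" "y = g a'" using gA by blast
    then obtain C where "C \<in> d" "a' \<in> C" "y \<in> C" using g by blast
    then have "a' \<in> B" using disj[OF B _ y] by blast
    then show ?thesis using one[OF B a(1) a'(1) a(2)] a' by simp
  qed
  ultimately have "B = {a, g a}" using a by blast
  then show ?thesis using a g by blast
qed

lemma perm_diagrams_iff:
  "d \<in> perm_diagrams n \<longleftrightarrow> d \<in> diagrams n \<and> (\<forall>B\<in>d. \<exists>i\<in>pos n. \<exists>j\<in>pos n. B = {- i, j})"
proof -
  have "(is_perm_block B \<longleftrightarrow> (\<exists>i\<in>pos n. \<exists>j\<in>pos n. B = {- i, j}))" if "d \<in> diagrams n" "B \<in> d" for B
  proof
    assume "is_perm_block B"
    then obtain i j where ij: "0 < i" "0 < j" "B = {- i, j}" by (auto simp: is_perm_block_def)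
    then have "- i \<in> nodes n" "j \<in> nodes n" using block_subset_nodes[OF that] by auto
    with ij show "\<exists>i\<in>pos n. \<exists>j\<in>pos n. B = {- i, j}"
      by (intro bexI[of _ i] bexI[of _ j]) (auto simp: nodes_def)
  qed (force simp: is_perm_block_def)
  then show ?thesis by (auto simp: perm_diagrams_def)
qed

text \<open>The criterion mentions matrix entries only, so it can be tested on products. A nonzero
  entry in row \<open>{i}\<close> separates -i from all other left nodes; vanishing of the entry at
  (\<open>{i}\<close>, \<open>{}\<close>) excludes a singleton block of -i. Counting left and right
  nodes does the rest.\<close>

lemma perm_diagramI_left:
  assumes d: "d \<in> diagrams n"
    and one: "\<And>i. i \<in> pos n \<Longrightarrow> \<exists>R\<subseteq>pos n. compat d {i} R"
    and meets: "\<And>i. i \<in> pos n \<Longrightarrow> \<not> compat d {i} {}"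
  shows "d \<in> perm_diagrams n"
  unfolding perm_diagrams_iff
proof (intro conjI ballI d)
  fix B assume B: "B \<in> d"
  have *: "a = b" if B: "B \<in> d" "a \<in> uminus ` pos n" "b \<in> uminus ` pos n" "a \<in> B" "b \<in> B" for B a b
  proof -
    obtain i j where ij: "i \<in> pos n" "j \<in> pos n" "a = - i" "b = - j" using B(2,3) by blast
    obtain R where R: "R \<subseteq> pos n" "compat d {i} R" using one[OF ij(1)] by blast
    have "- i \<in> colouring {i} R" by (simp add: colouring_def)
    moreover have "- i \<in> B" "- j \<in> B" using B(4,5) unfolding ij .
    moreover have "B \<subseteq> colouring {i} R \<or> B \<inter> colouring {i} R = {}" using R(2) B(1) by (simp add: compat_def)
    ultimately have "- j \<in> colouring {i} R" by blast
    then show ?thesis using neg_in_colouring[OF R(1) ij(2)] ij by simp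
  qed
  have "\<exists>a\<in>uminus ` pos n. \<exists>b\<in>pos n. B = {a, b}"
  proof (rule partition_into_pairs[OF _ _ _ _ _ _ B])
    show "partition_on (uminus ` pos n \<union> pos n) d" using d by (simp add: diagrams_def nodes_eq)
    show "card (pos n) \<le> card (uminus ` pos n)" by (subst card_image) auto
    show "uminus ` pos n \<inter> pos n = {}" by auto
    show "a = b" if "B \<in> d" "a \<in> uminus ` pos n" "b \<in> uminus ` pos n" "a \<in> B" "b \<in> B" for B a b
      using *[OF that] .
    show "\<exists>b\<in>pos n. b \<in> B" if B: "B \<in> d" "a \<in> uminus ` pos n" "a \<in> B" for B a
    proof (rule ccontr)
      assume no: "\<not> ?thesis"
      obtain i where i: "i \<in> pos n" "a = - i" using B by blast
      have "b = a" if b: "b \<in> B" for b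
        using block_subset_nodes[OF d B(1)] no b *[OF B(1) _ B(2) b B(3)] by (auto simp: nodes_eq)
      then have "B = {a}" using B by blast
      then have "{- i} \<in> d" using i B by simp
      then have "compat d {i} {}"
        using compat_singleton_iff[OF d, of "{i}" "{}" "- i"] i by (auto simp: colouring_def nodes_eq)
      then show False using meets i by blast
    qed
  qed auto
  then show "\<exists>i\<in>pos n. \<exists>j\<in>pos n. B = {- i, j}" by blast
qed

lemma perm_diagramI_right:
  assumes d: "d \<in> diagrams n"
    and one: "\<And>i. i \<in> pos n \<Longrightarrow> \<exists>L\<subseteq>pos n. compat d L {i}"
    and meets: "\<And>i. i \<in> pos n \<Longrightarrow> \<not> compat d {} {i}"
  shows "d \<in> perm_diagrams n"
  unfolding perm_diagrams_iff
proof (intro conjI ballI d)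
  fix B assume B: "B \<in> d"
  have *: "i = j" if B: "B \<in> d" "i \<in> pos n" "j \<in> pos n" "i \<in> B" "j \<in> B" for B i j
  proof -
    obtain L where L: "L \<subseteq> pos n" "compat d L {i}" using one[OF B(2)] by blast
    have "i \<in> colouring L {i}" by (simp add: colouring_def)
    moreover have "B \<subseteq> colouring L {i} \<or> B \<inter> colouring L {i} = {}" using L(2) B(1) by (simp add: compat_def)
    ultimately have "j \<in> colouring L {i}" using B(4,5) by blast
    then show ?thesis using pos_in_colouring[OF L(1) B(3)] by simp
  qed
  have "\<exists>a\<in>pos n. \<exists>b\<in>uminus ` pos n. B = {a, b}"
  proof (rule partition_into_pairs[OF _ _ _ _ _ _ B])
    show "partition_on (pos n \<union> uminus ` pos n) d" using d by (simp add: diagrams_def nodes_eq Un_commute)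
    show "card (uminus ` pos n) \<le> card (pos n)" by (rule card_image_le) simp
    show "pos n \<inter> uminus ` pos n = {}" by auto
    show "a = b" if "B \<in> d" "a \<in> pos n" "b \<in> pos n" "a \<in> B" "b \<in> B" for B a b
      using *[OF that] .
    show "\<exists>b\<in>uminus ` pos n. b \<in> B" if B: "B \<in> d" "a \<in> pos n" "a \<in> B" for B a
    proof (rule ccontr)
      assume no: "\<not> ?thesis"
      have "b = a" if b: "b \<in> B" for b
        using block_subset_nodes[OF d B(1)] no b *[OF B(1) _ B(2) b B(3)] by (auto simp: nodes_eq)
      then have "B = {a}" using B by blast
      then have "{a} \<in> d" using B by simp
      then have "compat d {} {a}"
        using compat_singleton_iff[OF d, of "{}" "{a}" a] B(2) by (auto simp: colouring_def nodes_eq)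
      then show False using meets B(2) by blast
    qed
  qed auto
  then show "\<exists>i\<in>pos n. \<exists>j\<in>pos n. B = {- i, j}" by (metis imageE insert_commute)
qed

context
  fixes d n assumes d: "d \<in> perm_diagrams n"
begin

private lemma compat_pair:
  "{- i, j} \<in> d \<Longrightarrow> i \<in> pos n \<Longrightarrow> j \<in> pos n \<Longrightarrow> L \<subseteq> pos n \<Longrightarrow> R \<subseteq> pos n \<Longrightarrow> compat d L R \<Longrightarrow> i \<in> L \<longleftrightarrow> j \<in> R"
  using neg_in_colouring[of R n i L] pos_in_colouring[of L n j R] unfolding compat_def by fastforce

private lemma d': "d \<in> diagrams n" using d by (simp add: perm_diagrams_iff)

private lemma left_pair: "i \<in> pos n \<Longrightarrow> \<exists>j\<in>pos n. {- i, j} \<in> d"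
proof -
  assume i: "i \<in> pos n"
  then obtain B where B: "B \<in> d" "- i \<in> B" using diagram_blockE[OF d', of "- i"] by (auto simp: nodes_eq)
  then obtain i' j where "i' \<in> pos n" "j \<in> pos n" "B = {- i', j}" using d unfolding perm_diagrams_iff by blast
  with B i show ?thesis by auto
qed

private lemma right_pair: "j \<in> pos n \<Longrightarrow> \<exists>i\<in>pos n. {- i, j} \<in> d"
proof -
  assume j: "j \<in> pos n"
  then obtain B where B: "B \<in> d" "j \<in> B" using diagram_blockE[OF d', of j] by (auto simp: nodes_eq)
  then obtain i j' where "i \<in> pos n" "j' \<in> pos n" "B = {- i, j'}" using d unfolding perm_diagrams_iff by blast
  with B j show ?thesis by auto
qed

text \<open>With the next three lemmas: the matrix of \<open>d\<close> is a permutation matrix on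
  \<open>Pow (pos n)\<close>. A strand from -i to j forces i and j to have the same colour, so each
  side of a colouring determines the other.\<close>

lemma perm_compat_inj_left:
  assumes "L \<subseteq> pos n" "L' \<subseteq> pos n" "R \<subseteq> pos n" "compat d L R" "compat d L' R"
  shows "L = L'"
proof -
  have "i \<in> L \<longleftrightarrow> i \<in> L'" if i: "i \<in> pos n" for i
  proof -
    obtain j where j: "j \<in> pos n" "{- i, j} \<in> d" using left_pair[OF i] by blast
    show ?thesis
      using compat_pair[OF j(2) i j(1) assms(1,3,4)] compat_pair[OF j(2) i j(1) assms(2,3,5)] by simp
  qed
  then show ?thesis using assms(1,2) by blast
qed

lemma perm_compat_inj_right:
  assumes "L \<subseteq> pos n" "R \<subseteq> pos n" "R' \<subseteq> pos n" "compat d L R" "compat d L R'"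
  shows "R = R'"
proof -
  have "j \<in> R \<longleftrightarrow> j \<in> R'" if j: "j \<in> pos n" for j
  proof -
    obtain i where i: "i \<in> pos n" "{- i, j} \<in> d" using right_pair[OF j] by blast
    show ?thesis
      using compat_pair[OF i(2,1) j assms(1,2,4)] compat_pair[OF i(2,1) j assms(1,3,5)] by simp
  qed
  then show ?thesis using assms(2,3) by blast
qed

lemma perm_compat_total_left:
  assumes L: "L \<subseteq> pos n"
  obtains R where "R \<subseteq> pos n" "compat d L R"
proof -
  \<comment> \<open>The only possible colouring of the right side: \<open>L\<close> transported
    along the strands.\<close>
  let ?R = "{j \<in> pos n. \<exists>i\<in>L. {- i, j} \<in> d}"
  have "compat d L ?R"
    unfolding compat_def
  proof
    fix B assume B: "B \<in> d"
    then obtain i j where ij: "i \<in> pos n" "j \<in> pos n" "B = {- i, j}" using d unfolding perm_diagrams_iff by blast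
    have "j \<in> ?R \<longleftrightarrow> i \<in> L"
    proof
      assume "j \<in> ?R"
      then obtain i' where i': "i' \<in> L" "{- i', j} \<in> d" by blast
      then have "{- i', j} = B" using diagramsD(2)[OF d' _ B, of "{- i', j}" j] ij by blast
      then have "- i' \<in> {- i, j}" using ij by blast
      moreover have "- i' \<noteq> j" using i' ij L by force
      ultimately show "i \<in> L" using i' by simp
    qed (use ij B in blast)
    moreover have "?R \<subseteq> pos n" by blast
    ultimately show "B \<subseteq> colouring L ?R \<or> B \<inter> colouring L ?R = {}"
      using neg_in_colouring[of ?R n i L] pos_in_colouring[OF L, of j ?R] ij by blast
  qed
  then show ?thesis using that[of ?R] by blast
qed

lemma perm_compat_total_right:
  assumes R: "R \<subseteq> pos n"
  obtains L where "L \<subseteq> pos n" "compat d L R"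
proof -
  let ?L = "{i \<in> pos n. \<exists>j\<in>R. {- i, j} \<in> d}"
  have "compat d ?L R"
    unfolding compat_def
  proof
    fix B assume B: "B \<in> d"
    then obtain i j where ij: "i \<in> pos n" "j \<in> pos n" "B = {- i, j}" using d unfolding perm_diagrams_iff by blast
    have "i \<in> ?L \<longleftrightarrow> j \<in> R"
    proof
      assume "i \<in> ?L"
      then obtain j' where j': "j' \<in> R" "{- i, j'} \<in> d" by blast
      then have "{- i, j'} = B" using diagramsD(2)[OF d' _ B, of "{- i, j'}" "- i"] ij by blast
      then have "j' \<in> {- i, j}" using ij by blast
      moreover have "- i \<noteq> j'" using j' ij R by force
      ultimately show "j \<in> R" using j' by auto
    qed (use ij B in blast)
    moreover have "?L \<subseteq> pos n" by blast
    ultimately show "B \<subseteq> colouring ?L R \<or> B \<inter> colouring ?L R = {}"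
      using neg_in_colouring[OF R, of i ?L] pos_in_colouring[of ?L n j R] ij by blast
  qed
  then show ?thesis using that[of ?L] by blast
qed

end

lemma perm_diagrams_subset: "perm_diagrams n \<subseteq> diagrams n"
  by (auto simp: perm_diagrams_def)

text \<open>This makes the non-permutation diagrams a two-sided ideal. If the product is a
  permutation, a nonzero entry in a row of the product forces one in the same row of
  \<open>d1\<close>; and compatibility of \<open>d1\<close> with (\<open>{i}\<close>,
  \<open>{}\<close>) would, via the empty colouring of \<open>d2\<close>, give the product a second
  nonzero entry in column \<open>{}\<close>. Columns of \<open>d2\<close> are treated in the same
  way.\<close>

lemma diag_comp_perm_iff:
  assumes d: "d1 \<in> diagrams n" "d2 \<in> diagrams n"
  shows "diag_comp d1 d2 \<in> perm_diagrams n \<longleftrightarrow> d1 \<in> perm_diagrams n \<and> d2 \<in> perm_diagrams n"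
proof
  assume p: "diag_comp d1 d2 \<in> perm_diagrams n"
  show "d1 \<in> perm_diagrams n \<and> d2 \<in> perm_diagrams n"
  proof
    show "d1 \<in> perm_diagrams n"
    proof (rule perm_diagramI_left[OF d(1)])
      fix i assume i: "i \<in> pos n"
      obtain R where R: "R \<subseteq> pos n" "compat (diag_comp d1 d2) {i} R"
        using perm_compat_total_left[OF p, of "{i}"] i by blast
      show "\<exists>R\<subseteq>pos n. compat d1 {i} R"
        using compat_diag_compE[OF d _ R] i by blast
      show "\<not> compat d1 {i} {}"
      proof
        assume "compat d1 {i} {}"
        then have "compat (diag_comp d1 d2) {i} {}"
          using compat_diag_compI[OF d, of "{i}" "{}" "{}"] compat_empty i by blast
        then show False using perm_compat_inj_left[OF p, of "{i}" "{}" "{}"] compat_empty i by blast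
      qed
    qed
    show "d2 \<in> perm_diagrams n"
    proof (rule perm_diagramI_right[OF d(2)])
      fix i assume i: "i \<in> pos n"
      obtain L where L: "L \<subseteq> pos n" "compat (diag_comp d1 d2) L {i}"
        using perm_compat_total_right[OF p, of "{i}"] i by blast
      show "\<exists>L\<subseteq>pos n. compat d2 L {i}"
        using compat_diag_compE[OF d L(1) _ L(2)] i by blast
      show "\<not> compat d2 {} {i}"
      proof
        assume "compat d2 {} {i}"
        then have "compat (diag_comp d1 d2) {} {i}"
          using compat_diag_compI[OF d, of "{}" "{i}" "{}"] compat_empty i by blast
        then show False using perm_compat_inj_right[OF p, of "{}" "{i}" "{}"] compat_empty i by blast
      qed
    qed
  qed
next
  assume p: "d1 \<in> perm_diagrams n \<and> d2 \<in> perm_diagrams n"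
  show "diag_comp d1 d2 \<in> perm_diagrams n"
  proof (rule perm_diagramI_left[OF diag_comp_diagrams[OF d]])
    fix i assume i: "i \<in> pos n"
    obtain H where H: "H \<subseteq> pos n" "compat d1 {i} H"
      using perm_compat_total_left[of d1 n "{i}"] p i by blast
    obtain R where R: "R \<subseteq> pos n" "compat d2 H R"
      using perm_compat_total_left[of d2 n H] p H by blast
    show "\<exists>R\<subseteq>pos n. compat (diag_comp d1 d2) {i} R"
      using compat_diag_compI[OF d _ R(1) H(1)] R H i by blast
    show "\<not> compat (diag_comp d1 d2) {i} {}"
    proof
      assume c: "compat (diag_comp d1 d2) {i} {}"
      obtain H where H: "H \<subseteq> pos n" "compat d1 {i} H" "compat d2 H {}"
        using compat_diag_compE[OF d _ _ c] i by blast
      have "H = {}" using perm_compat_inj_left[of d2 n H "{}" "{}"] p H compat_empty by blast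
      then show False using perm_compat_inj_left[of d1 n "{i}" "{}" "{}"] p H i compat_empty by blast
    qed
  qed
qed

text \<open>In the row of the full colouring only the full middle colouring survives, so 2^c is at
  most 1.\<close>

lemma closed_loops_perm:
  assumes p: "d1 \<in> perm_diagrams n" "d2 \<in> perm_diagrams n"
  shows "closed_loops d1 d2 = 0"
proof -
  note d = subsetD[OF perm_diagrams_subset p(1)] subsetD[OF perm_diagrams_subset p(2)]
  let ?S = "{H \<in> Pow (pos n). compat d1 (pos n) H \<and> compat d2 H (pos n)}"
  have "card ?S = 2 ^ closed_loops d1 d2"
    using card_compat_both[OF d, of "pos n" "pos n"] compat_full[OF diag_comp_diagrams[OF d]] by simp
  moreover have "?S \<subseteq> {pos n}"
    using perm_compat_inj_right[OF p(1), of "pos n" "pos n"] compat_full[OF d(1)] by blast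
  then have "card ?S \<le> 1" using card_mono[of "{pos n}" ?S] by simp
  ultimately have "\<not> 2 ^ 0 < (2::nat) ^ closed_loops d1 d2" by simp
  then show ?thesis by (metis gr0I one_less_numeral_iff power_strict_increasing_iff semiring_norm(76))
qed

lemma eps_diagram: "d \<in> diagrams n \<Longrightarrow> eps d = (if d \<in> perm_diagrams n then 1 else 0)"
  by (simp add: eps_def perm_diagrams_def)

text \<open>Multiplicativity of the augmentation gives the simplicial identity between an outer face
  and the inner face next to it. Loops could matter only when the product is a permutation, and then
  there are none.\<close>

lemma eps_diag_comp:
  fixes \<delta> :: "'r::comm_ring_1"
  assumes "d1 \<in> diagrams n" "d2 \<in> diagrams n"
  shows "\<delta> ^ closed_loops d1 d2 * eps (diag_comp d1 d2) = eps d1 * eps d2"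
  using assms by (simp add: eps_diagram[of _ n] diag_comp_diagrams diag_comp_perm_iff closed_loops_perm)

section \<open>Idempotents generating left ideals\<close>

text \<open>For \<open>R\<close> inside \<open>pos n\<close>: a union of traces that blocks leave on
  the right nodes or, equivalently by \<open>right_saturated_iff\<close>, a nonzero column of the
  matrix of \<open>d\<close>.\<close>

definition right_saturated :: "int set set \<Rightarrow> nat \<Rightarrow> int set \<Rightarrow> bool" where
  "right_saturated d n R \<longleftrightarrow> (\<forall>B\<in>d. B \<inter> pos n \<subseteq> R \<or> B \<inter> R = {})"

lemma right_saturated_iff:
  assumes d: "d \<in> diagrams n" and R: "R \<subseteq> pos n"
  shows "right_saturated d n R \<longleftrightarrow> (\<exists>L\<subseteq>pos n. compat d L R)"
proof
  assume "\<exists>L\<subseteq>pos n. compat d L R"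
  then obtain L where L: "L \<subseteq> pos n" "compat d L R" by blast
  have "colouring L R \<inter> pos n = R" using L(1) R by (auto simp: colouring_def)
  then show "right_saturated d n R"
    using L(2) unfolding right_saturated_def compat_def by blast
next
  assume r: "right_saturated d n R"
  \<comment> \<open>Colour exactly the left nodes attached to a coloured right node; saturation
    makes the colour of a block well defined.\<close>
  let ?L = "{i \<in> pos n. \<exists>B\<in>d. - i \<in> B \<and> B \<inter> R \<noteq> {}}"
  have "compat d ?L R"
    unfolding compat_def
  proof
    fix B assume B: "B \<in> d"
    show "B \<subseteq> colouring ?L R \<or> B \<inter> colouring ?L R = {}"
    proof (cases "B \<inter> R = {}")
      case True
      have "x \<notin> colouring ?L R" if x: "x \<in> B" for x
        using block_subset_nodes[OF d B, THEN subsetD, OF x]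
      proof (cases rule: nodes_cases)
        case (1 i)
        have "i \<notin> ?L"
        proof
          assume "i \<in> ?L"
          then obtain B' where B': "B' \<in> d" "- i \<in> B'" "B' \<inter> R \<noteq> {}" by blast
          then have "B' = B" using diagramsD(2)[OF d _ B] x 1 by blast
          with B' True show False by blast
        qed
        then show ?thesis using neg_in_colouring[OF R 1(1), of ?L] 1(2) by simp
      next
        case 2
        then show ?thesis using pos_in_colouring[of ?L n x R] True x by blast
      qed
      then show ?thesis by blast
    next
      case False
      then have BR: "B \<inter> pos n \<subseteq> R" using r B unfolding right_saturated_def by blast
      have "x \<in> colouring ?L R" if x: "x \<in> B" for x
        using block_subset_nodes[OF d B, THEN subsetD, OF x]
      proof (cases rule: nodes_cases)
        case (1 i)
        then have "i \<in> ?L" using B x False by blast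
        then show ?thesis using 1(2) by (simp add: colouring_def)
      next
        case 2
        then show ?thesis using BR x by (auto simp: colouring_def)
      qed
      then show ?thesis by blast
    qed
  qed
  moreover have "?L \<subseteq> pos n" by blast
  ultimately show "\<exists>L\<subseteq>pos n. compat d L R" by (intro exI[of _ ?L] conjI)
qed

definition right_singletons :: "int set set \<Rightarrow> nat \<Rightarrow> int set" where
  "right_singletons d n = {i \<in> pos n. {i} \<in> d}"

lemma compat_right_singleton:
  assumes "d \<in> diagrams n" "i \<in> pos n"
  shows "compat d {} {i} \<longleftrightarrow> i \<in> right_singletons d n"
  using compat_singleton_iff[OF assms(1), of "{}" "{i}" i] assms(2)
  by (simp add: colouring_def right_singletons_def nodes_eq)

text \<open>The basis of a left ideal; the word \<open>right\<close> refers to the pattern on the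
  right nodes. The right pattern of \<open>z\<close> is at least as coarse as that of
  \<open>y\<close>: singletons persist, and a column that is nonzero for \<open>z\<close> is nonzero
  for \<open>y\<close>.\<close>

definition right_ideal_cell :: "nat \<Rightarrow> int set set \<Rightarrow> int set set set" where
  "right_ideal_cell n y = {z \<in> diagrams n - perm_diagrams n.
     right_singletons y n \<subseteq> right_singletons z n \<and>
     (\<forall>R\<subseteq>pos n. right_saturated z n R \<longrightarrow> right_saturated y n R)}"

text \<open>Multiplication from the left combines rows of the matrix of \<open>z\<close>: it creates
  no new nonzero columns, and the entry at (\<open>{}\<close>, \<open>{i}\<close>) survives because
  the entry of \<open>a\<close> at (\<open>{}\<close>, \<open>{}\<close>) is 1.\<close>

lemma right_ideal_cell_left_ideal:
  assumes a: "a \<in> diagrams n" and z: "z \<in> right_ideal_cell n y"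
  shows "diag_comp a z \<in> right_ideal_cell n y"
proof -
  have zd: "z \<in> diagrams n" "z \<notin> perm_diagrams n"
    and sing: "right_singletons y n \<subseteq> right_singletons z n"
    using z by (auto simp: right_ideal_cell_def)
  have sat: "right_saturated y n R" if "R \<subseteq> pos n" "right_saturated z n R" for R
    using z that by (simp add: right_ideal_cell_def)
  note az = diag_comp_diagrams[OF a zd(1)]
  have "right_singletons z n \<subseteq> right_singletons (diag_comp a z) n"
  proof
    fix i assume i: "i \<in> right_singletons z n"
    then have "i \<in> pos n" by (simp add: right_singletons_def)
    then show "i \<in> right_singletons (diag_comp a z) n"
      using i compat_right_singleton[OF zd(1)] compat_right_singleton[OF az]
        compat_diag_compI[OF a zd(1), of "{}" "{i}" "{}"] compat_empty by blast
  qed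
  moreover have "right_saturated z n R" if R: "R \<subseteq> pos n" "right_saturated (diag_comp a z) n R" for R
  proof -
    obtain L where L: "L \<subseteq> pos n" "compat (diag_comp a z) L R"
      using R right_saturated_iff[OF az] by blast
    obtain H where "H \<subseteq> pos n" "compat z H R"
      using compat_diag_compE[OF a zd(1) L(1) R(1) L(2)] by blast
    then show ?thesis using right_saturated_iff[OF zd(1) R(1)] by blast
  qed
  moreover have "diag_comp a z \<notin> perm_diagrams n"
    using diag_comp_perm_iff[OF a zd(1)] zd(2) by blast
  ultimately show ?thesis
    using az sing sat unfolding right_ideal_cell_def by blast
qed

text \<open>A right singleton of \<open>y\<close> becomes a cut strand, that is, a singleton on
  either side; every other trace on the right is doubled to one block with its mirror image. For a
  trace of at least two nodes it makes no difference whether its block reaches the left side, while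
  a one-node trace is cut only if its block is a singleton.\<close>

definition right_idempotent :: "nat \<Rightarrow> int set set \<Rightarrow> int set set" where
  "right_idempotent n y = (\<lambda>i. {i}) ` right_singletons y n \<union> (\<lambda>i. {- i}) ` right_singletons y n \<union>
     {uminus ` (B \<inter> pos n) \<union> (B \<inter> pos n) | B. B \<in> y \<and> B \<inter> pos n \<noteq> {} \<and> B \<inter> right_singletons y n = {}}"

lemma colouring_Int:
  assumes "A \<subseteq> pos n" "B \<subseteq> pos n" "L \<subseteq> pos n" "R \<subseteq> pos n"
  shows "colouring A B \<inter> colouring L R = colouring (A \<inter> L) (B \<inter> R)"
proof -
  have "uminus ` A \<inter> R = {}" "B \<inter> uminus ` L = {}" using assms by force+
  moreover have "uminus ` A \<inter> uminus ` L = uminus ` (A \<inter> L)" by (simp add: image_Int)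
  ultimately show ?thesis unfolding colouring_def by blast
qed

lemma colouring_subset:
  assumes "A \<subseteq> pos n" "B \<subseteq> pos n" "L \<subseteq> pos n" "R \<subseteq> pos n"
  shows "colouring A B \<subseteq> colouring L R \<longleftrightarrow> A \<subseteq> L \<and> B \<subseteq> R"
proof -
  have "uminus ` A \<inter> R = {}" "B \<inter> uminus ` L = {}" using assms by force+
  then have "colouring A B \<subseteq> colouring L R \<longleftrightarrow> uminus ` A \<subseteq> uminus ` L \<and> B \<subseteq> R"
    unfolding colouring_def by blast
  then show ?thesis by (simp add: inj_image_subset_iff)
qed

lemma colouring_empty_iff: "colouring A B = {} \<longleftrightarrow> A = {} \<and> B = {}"
  by (simp add: colouring_def)

context
  fixes y n assumes y: "y \<in> diagrams n"
begin

private abbreviation "U \<equiv> right_singletons y n"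

private lemma U_pos: "U \<subseteq> pos n" by (auto simp: right_singletons_def)

private lemma U_block: "B \<in> y \<Longrightarrow> i \<in> B \<Longrightarrow> i \<in> U \<Longrightarrow> B = {i}"
  unfolding right_singletons_def using diagramsD(2)[OF y, of B "{i}" i] by blast

private lemma right_idempotent_eq:
  "right_idempotent n y = (\<lambda>i. colouring {} {i}) ` U \<union> (\<lambda>i. colouring {i} {}) ` U \<union>
     {colouring (B \<inter> pos n) (B \<inter> pos n) | B. B \<in> y \<and> B \<inter> pos n \<noteq> {} \<and> B \<inter> U = {}}"
  by (simp add: right_idempotent_def colouring_def)

private lemma block_of: "i \<in> pos n \<Longrightarrow> \<exists>B\<in>y. i \<in> B"
  using diagramsD(1)[OF y] unfolding nodes_eq by blast

lemma right_idempotent_diagram: "right_idempotent n y \<in> diagrams n"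
  unfolding diagrams_def mem_Collect_eq
proof (rule partition_onI)
  let ?e = "right_idempotent n y"
  have sub: "p \<subseteq> nodes n" "p \<noteq> {}" if p: "p \<in> ?e" for p
    using p U_pos unfolding right_idempotent_eq by (auto simp: colouring_def nodes_eq)
  have cover: "\<exists>p\<in>?e. i \<in> p" "\<exists>p\<in>?e. - i \<in> p" if i: "i \<in> pos n" for i
  proof -
    have "(\<exists>p\<in>?e. i \<in> p) \<and> (\<exists>p\<in>?e. - i \<in> p)"
    proof (cases "i \<in> U")
      case True
      then have "{i} \<in> ?e" "{- i} \<in> ?e" by (auto simp: right_idempotent_def)
      then show ?thesis by blast
    next
      case False
      obtain B where B: "B \<in> y" "i \<in> B" using block_of[OF i] by blast
      have "B \<inter> U = {}" using U_block[OF B(1)] B(2) False by blast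
      then have "uminus ` (B \<inter> pos n) \<union> (B \<inter> pos n) \<in> ?e" using B i unfolding right_idempotent_def by blast
      then show ?thesis using B i by (intro conjI bexI) auto
    qed
    then show "\<exists>p\<in>?e. i \<in> p" "\<exists>p\<in>?e. - i \<in> p" by auto
  qed
  show "\<Union>?e = nodes n"
  proof
    show "\<Union>?e \<subseteq> nodes n" using sub by blast
    show "nodes n \<subseteq> \<Union>?e"
      using cover by (auto elim!: nodes_cases)
  qed
  show "{} \<notin> ?e" using sub(2) by blast
  fix p q assume pq: "p \<in> ?e" "q \<in> ?e" "p \<noteq> q"
  \<comment> \<open>A normal form for blocks as pairs of label sets: a singleton on one side only,
    or a doubled trace away from \<open>U\<close>. Disjointness of blocks becomes disjointness of
    the label sets.\<close>
  have form: "\<exists>A B. p = colouring A B \<and> A \<subseteq> pos n \<and> B \<subseteq> pos n \<and>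
     ((A = {} \<and> (\<exists>i\<in>U. B = {i})) \<or> (B = {} \<and> (\<exists>i\<in>U. A = {i})) \<or>
      (A = B \<and> (\<exists>C\<in>y. A = C \<inter> pos n) \<and> A \<inter> U = {}))" if "p \<in> ?e" for p
    using that unfolding right_idempotent_eq
  proof (elim UnE)
    assume "p \<in> (\<lambda>i. colouring {} {i}) ` U"
    then show ?thesis using U_pos by blast
  next
    assume "p \<in> (\<lambda>i. colouring {i} {}) ` U"
    then show ?thesis using U_pos by blast
  next
    assume "p \<in> {colouring (B \<inter> pos n) (B \<inter> pos n) | B. B \<in> y \<and> B \<inter> pos n \<noteq> {} \<and> B \<inter> U = {}}"
    then obtain B where "B \<in> y" "B \<inter> U = {}" "p = colouring (B \<inter> pos n) (B \<inter> pos n)" by blast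
    then show ?thesis by (intro exI[of _ "B \<inter> pos n"]) blast
  qed
  obtain A B where p: "p = colouring A B" "A \<subseteq> pos n" "B \<subseteq> pos n"
     "((A = {} \<and> (\<exists>i\<in>U. B = {i})) \<or> (B = {} \<and> (\<exists>i\<in>U. A = {i})) \<or>
      (A = B \<and> (\<exists>C\<in>y. A = C \<inter> pos n) \<and> A \<inter> U = {}))"
    using form[OF pq(1)] by blast
  obtain A' B' where q: "q = colouring A' B'" "A' \<subseteq> pos n" "B' \<subseteq> pos n"
     "((A' = {} \<and> (\<exists>i\<in>U. B' = {i})) \<or> (B' = {} \<and> (\<exists>i\<in>U. A' = {i})) \<or>
      (A' = B' \<and> (\<exists>C\<in>y. A' = C \<inter> pos n) \<and> A' \<inter> U = {}))"
    using form[OF pq(2)] by blast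
  have disj: "C \<inter> pos n = C' \<inter> pos n \<or> (C \<inter> pos n) \<inter> (C' \<inter> pos n) = {}" if "C \<in> y" "C' \<in> y" for C C'
    using diagramsD(2)[OF y that] by blast
  have "A \<inter> A' = {} \<and> B \<inter> B' = {}"
    using p(4)
  proof (elim disjE)
    assume a: "A = {} \<and> (\<exists>i\<in>U. B = {i})"
    show ?thesis using q(4) a pq(3) unfolding p(1) q(1) by blast
  next
    assume a: "B = {} \<and> (\<exists>i\<in>U. A = {i})"
    show ?thesis using q(4) a pq(3) unfolding p(1) q(1) by blast
  next
    assume a: "A = B \<and> (\<exists>C\<in>y. A = C \<inter> pos n) \<and> A \<inter> U = {}"
    show ?thesis using q(4)
    proof (elim disjE)
      assume b: "A' = B' \<and> (\<exists>C\<in>y. A' = C \<inter> pos n) \<and> A' \<inter> U = {}"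
      then have "A = A' \<or> A \<inter> A' = {}" using a disj by blast
      then show ?thesis using a b pq(3) unfolding p(1) q(1) by blast
    qed (use a in blast)+
  qed
  then show "disjnt p q"
    unfolding disjnt_def p(1) q(1) colouring_Int[OF p(2,3) q(2,3)] colouring_empty_iff .
qed

text \<open>Cut strands impose no condition, so \<open>H\<close> and \<open>R\<close> may differ on
  \<open>U\<close>. Elsewhere a doubled trace forces both sides to agree and to be constant on the
  trace.\<close>

lemma compat_right_idempotent:
  assumes HR: "H \<subseteq> pos n" "R \<subseteq> pos n"
  shows "compat (right_idempotent n y) H R \<longleftrightarrow> H - U = R - U \<and> right_saturated y n R"
proof -
  let ?D = "\<lambda>B. colouring (B \<inter> pos n) (B \<inter> pos n)"
  have D: "(?D B \<subseteq> colouring H R \<or> ?D B \<inter> colouring H R = {}) \<longleftrightarrow>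
     (B \<inter> pos n \<subseteq> H \<and> B \<inter> pos n \<subseteq> R) \<or> (B \<inter> H = {} \<and> B \<inter> R = {})" for B
  proof -
    have "B \<inter> pos n \<inter> H = B \<inter> H" "B \<inter> pos n \<inter> R = B \<inter> R" using HR by auto
    then show ?thesis
      using colouring_Int[of "B \<inter> pos n" n "B \<inter> pos n" H R] colouring_subset[of "B \<inter> pos n" n "B \<inter> pos n" H R] HR
      by (simp add: colouring_empty_iff)
  qed
  have one: "colouring {} {i} \<subseteq> colouring H R \<or> colouring {} {i} \<inter> colouring H R = {}" for i
    by (auto simp: colouring_def)
  have two: "colouring {i} {} \<subseteq> colouring H R \<or> colouring {i} {} \<inter> colouring H R = {}" for i
    by (auto simp: colouring_def)
  have "compat (right_idempotent n y) H R \<longleftrightarrow>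
      (\<forall>B\<in>y. B \<inter> pos n \<noteq> {} \<and> B \<inter> U = {} \<longrightarrow> ?D B \<subseteq> colouring H R \<or> ?D B \<inter> colouring H R = {})"
    unfolding compat_def right_idempotent_eq ball_Un ball_simps
    by (simp only: one two simp_thms) (simp only: Ball_def mem_Collect_eq, metis)
  also have "\<dots> \<longleftrightarrow> (\<forall>B\<in>y. B \<inter> pos n \<noteq> {} \<and> B \<inter> U = {} \<longrightarrow>
      (B \<inter> pos n \<subseteq> H \<and> B \<inter> pos n \<subseteq> R) \<or> (B \<inter> H = {} \<and> B \<inter> R = {}))"
    unfolding D ..
  also have "\<dots> \<longleftrightarrow> H - U = R - U \<and> right_saturated y n R" (is "?l \<longleftrightarrow> ?r")
  proof
    assume l: ?l
    have "i \<in> H \<longleftrightarrow> i \<in> R" if i: "i \<in> pos n" "i \<notin> U" for i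
    proof -
      obtain B where B: "B \<in> y" "i \<in> B" using block_of[OF i(1)] by blast
      have "B \<inter> U = {}" using U_block[OF B(1)] B(2) i(2) by blast
      then show ?thesis using l B i by blast
    qed
    then have "H - U = R - U" using HR by blast
    moreover have "B \<inter> pos n \<subseteq> R \<or> B \<inter> R = {}" if B: "B \<in> y" for B
    proof (cases "B \<inter> U = {}")
      case True
      then show ?thesis using l B HR by blast
    next
      case False
      then obtain i where "B = {i}" using U_block[OF B] by blast
      then show ?thesis by blast
    qed
    ultimately show ?r unfolding right_saturated_def by blast
  next
    assume r: ?r
    show ?l
    proof (intro ballI impI)
      fix B assume B: "B \<in> y" "B \<inter> pos n \<noteq> {} \<and> B \<inter> U = {}"
      have "B \<inter> pos n \<subseteq> R \<or> B \<inter> R = {}" using r B unfolding right_saturated_def by blast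
      moreover have "B \<inter> H = B \<inter> R" using r B by blast
      ultimately show "(B \<inter> pos n \<subseteq> H \<and> B \<inter> pos n \<subseteq> R) \<or> (B \<inter> H = {} \<and> B \<inter> R = {})" by blast
    qed
  qed
  finally show ?thesis .
qed

text \<open>The idempotent has to belong to its own ideal, so that appending it stays in the
  subcomplex and its augmentation vanishes. Were it a permutation, \<open>U\<close> would be empty
  and every \<open>{i}\<close> saturated for \<open>y\<close>, and \<open>y\<close> would meet the
  criterion for permutations.\<close>

lemma right_idempotent_in_cell:
  assumes np: "y \<notin> perm_diagrams n"
  shows "right_idempotent n y \<in> right_ideal_cell n y"
proof -
  let ?e = "right_idempotent n y"
  have sat: "right_saturated y n R" if "R \<subseteq> pos n" "right_saturated ?e n R" for R
    using that right_saturated_iff[OF right_idempotent_diagram] compat_right_idempotent by blast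
  have sing: "U \<subseteq> right_singletons ?e n"
  proof
    fix i assume "i \<in> U"
    then show "i \<in> right_singletons ?e n"
      by (auto simp: right_singletons_def right_idempotent_def)
  qed
  have "?e \<notin> perm_diagrams n"
  proof
    assume p: "?e \<in> perm_diagrams n"
    have U: "U = {}"
    proof (rule ccontr)
      assume "U \<noteq> {}"
      then obtain i where i: "i \<in> U" by blast
      then have "i \<in> pos n" "i \<in> right_singletons ?e n" using U_pos sing by blast+
      then have "compat ?e {} {i}" using compat_right_singleton[OF right_idempotent_diagram] by blast
      then show False
        using perm_compat_inj_right[OF p, of "{}" "{}" "{i}"] compat_empty \<open>i \<in> pos n\<close> by blast
    qed
    have "y \<in> perm_diagrams n"
    proof (rule perm_diagramI_right[OF y])
      fix i assume i: "i \<in> pos n"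
      then obtain H where H: "H \<subseteq> pos n" "compat ?e H {i}"
        using perm_compat_total_right[OF p, of "{i}"] by blast
      then have "right_saturated y n {i}" using compat_right_idempotent[OF H(1), of "{i}"] i by blast
      then show "\<exists>L\<subseteq>pos n. compat y L {i}" using right_saturated_iff[OF y, of "{i}"] i by blast
      show "\<not> compat y {} {i}" using compat_right_singleton[OF y i] U by blast
    qed
    with np show False by blast
  qed
  then show ?thesis
    using sat sing right_idempotent_diagram unfolding right_ideal_cell_def by blast
qed

text \<open>In entry (L, R) of the product matrix only those \<open>H\<close> agreeing with
  \<open>R\<close> off \<open>U\<close> contribute, and \<open>z\<close> does not see colours on
  \<open>U\<close>, where its blocks are singletons. One free choice remains for each element of
  \<open>U\<close>, hence as many closed loops. When column \<open>R\<close> of \<open>z\<close> is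
  nonzero, membership in the cell supplies the saturation that the idempotent requires.\<close>

lemma diag_comp_right_idempotent:
  assumes z: "z \<in> right_ideal_cell n y"
  shows "closed_loops z (right_idempotent n y) = card U" "diag_comp z (right_idempotent n y) = z"
proof -
  let ?e = "right_idempotent n y"
  have zd: "z \<in> diagrams n" and sing: "U \<subseteq> right_singletons z n"
    using z by (auto simp: right_ideal_cell_def)
  have sat: "right_saturated y n R" if "R \<subseteq> pos n" "right_saturated z n R" for R
    using z that by (simp add: right_ideal_cell_def)
  note e = right_idempotent_diagram
  have transfer: "compat z L R" if LHR: "L \<subseteq> pos n" "H \<subseteq> pos n" "R \<subseteq> pos n" and c: "compat z L H" and eq: "H - U = R - U" for L H R
    unfolding compat_def
  proof
    fix B assume B: "B \<in> z"
    show "B \<subseteq> colouring L R \<or> B \<inter> colouring L R = {}"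
    proof (cases "B \<inter> U = {}")
      case True
      then have "B \<inter> colouring L R = B \<inter> colouring L H" using eq unfolding colouring_def by blast
      then show ?thesis using c B unfolding compat_def by blast
    next
      case False
      then obtain i where i: "i \<in> B" "i \<in> U" by blast
      then have "{i} \<in> z" using sing by (auto simp: right_singletons_def)
      then have "B = {i}" using diagramsD(2)[OF zd B] i by blast
      then show ?thesis by blast
    qed
  qed
  have "card {H \<in> Pow (pos n). compat z L H \<and> compat ?e H R} = 2 ^ card U * of_bool (compat z L R)"
    if LR: "L \<subseteq> pos n" "R \<subseteq> pos n" for L R
  proof (cases "compat z L R")
    case False
    then have "{H \<in> Pow (pos n). compat z L H \<and> compat ?e H R} = {}"
      using transfer[OF LR(1) _ LR(2)] compat_right_idempotent[OF _ LR(2)] by blast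
    then show ?thesis using False by simp
  next
    case True
    then have "right_saturated y n R" using sat[OF LR(2)] right_saturated_iff[OF zd LR(2)] LR(1) by blast
    then have "{H \<in> Pow (pos n). compat z L H \<and> compat ?e H R} = {H \<in> Pow (pos n). H - U = R - U}"
      using transfer[OF LR _ True] compat_right_idempotent[OF _ LR(2)] by blast
    also have "bij_betw (\<lambda>V. V \<union> (R - U)) (Pow U) {H \<in> Pow (pos n). H - U = R - U}"
      by (rule bij_betw_byWitness[where f' = "\<lambda>H. H \<inter> U"]) (use U_pos LR in blast)+
    then have "card {H \<in> Pow (pos n). H - U = R - U} = card (Pow U)"
      by (rule bij_betw_same_card[symmetric])
    also have "\<dots> = 2 ^ card U"
      by (rule card_Pow) (rule finite_subset[OF U_pos], simp)
    finally show ?thesis using True by simp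
  qed
  then have "2 ^ closed_loops z ?e * of_bool (compat (diag_comp z ?e) L R) = (2 ^ card U * of_bool (compat z L R) :: nat)"
    if "L \<subseteq> pos n" "R \<subseteq> pos n" for L R
    using that card_compat_both[OF zd e that] by simp
  note eq = loops_and_diagram_eqI[OF diag_comp_diagrams[OF zd e] zd this]
  show "closed_loops z ?e = card U" by (rule eq(1))
  show "diag_comp z ?e = z" by (rule eq(2))
qed

end

section \<open>Faces of the bar complex\<close>

text \<open>A face of a basis tuple is a scalar times one basis tuple; separating the two turns the
  simplicial identities into equations between lists and equations between scalars.\<close>

definition face_list :: "int set set list \<Rightarrow> nat \<Rightarrow> int set set list" where
  "face_list xs i = (if i = 0 then tl xs else if i = length xs then butlast xs
     else take (i - 1) xs @ [diag_comp (xs ! (i - 1)) (xs ! i)] @ drop (i + 1) xs)"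

definition face_coeff :: "'r::comm_ring_1 \<Rightarrow> int set set list \<Rightarrow> nat \<Rightarrow> 'r" where
  "face_coeff \<delta> xs i = (if i = 0 then eps (hd xs) else if i = length xs then eps (last xs)
     else \<delta> ^ closed_loops (xs ! (i - 1)) (xs ! i))"

lemma bar_face_eq: "bar_face \<delta> xs i = single (face_list xs i) (face_coeff \<delta> xs i)"
  by (simp add: bar_face_def face_list_def face_coeff_def)

lemma face_0:
  "face_list (x # xs) 0 = xs" "face_coeff \<delta> (x # xs) 0 = eps x"
  by (simp_all add: face_list_def face_coeff_def)

lemma face_inner:
  assumes "xs = us @ x # y # vs" "i = Suc (length us)"
  shows "face_list xs i = us @ diag_comp x y # vs" "face_coeff \<delta> xs i = \<delta> ^ closed_loops x y"
  using assms by (simp_all add: face_list_def face_coeff_def nth_append)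

lemma face_last:
  assumes "xs = us @ [x]" "i = Suc (length us)"
  shows "face_list xs i = us" "face_coeff \<delta> xs i = eps x"
  using assms by (simp_all add: face_list_def face_coeff_def)

lemma split_inner:
  assumes "0 < i" "i < length xs"
  obtains us x y vs where "xs = us @ x # y # vs" "i = Suc (length us)"
proof -
  have "xs = take (i - 1) xs @ xs ! (i - 1) # xs ! i # drop (Suc i) xs"
    using assms id_take_nth_drop[of "i - 1" xs] Cons_nth_drop_Suc[of i xs] by simp
  moreover have "i = Suc (length (take (i - 1) xs))" using assms by simp
  ultimately show ?thesis by (rule that)
qed

lemma face_cases [consumes 2, case_names first inner last]:
  assumes "xs \<noteq> []" "i \<le> length xs"
  obtains (first) x ys where "i = 0" "xs = x # ys"
  | (inner) us x y vs where "xs = us @ x # y # vs" "i = Suc (length us)"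
  | (last) us x where "xs = us @ [x]" "i = Suc (length us)"
proof (cases "i = 0")
  case True
  then show ?thesis using first assms by (cases xs) auto
next
  case False
  show ?thesis
  proof (cases "i = length xs")
    case True
    then show ?thesis using last[of "butlast xs" "last xs"] assms by simp
  next
    case 2: False
    then show ?thesis using split_inner[of i xs] False assms inner by (metis le_neq_implies_less neq0_conv)
  qed
qed

text \<open>The simplicial identities with their scalars. Disjoint positions commute; adjacent inner
  positions use associativity with its loop identity; an outer face next to an inner one uses
  multiplicativity of the augmentation. Length at least 2 keeps the result of the first face
  nonempty, so that \<open>hd\<close> and \<open>last\<close> are meaningful in the second.\<close>

lemma face_face:
  fixes \<delta> :: "'r::comm_ring_1"
  assumes xs: "set xs \<subseteq> diagrams n" "2 \<le> length xs" and ij: "i < j" "j \<le> length xs"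
  shows "face_list (face_list xs j) i = face_list (face_list xs i) (j - 1) \<and>
    face_coeff \<delta> xs j * face_coeff \<delta> (face_list xs j) i =
    face_coeff \<delta> xs i * face_coeff \<delta> (face_list xs i) (j - 1)"
proof -
  have ne: "xs \<noteq> []" using xs(2) by auto
  have i: "i \<le> length xs" using ij by simp
  from ne i show ?thesis
  proof (cases rule: face_cases)
    case (first x ys)
    from ne ij(2) show ?thesis
    proof (cases rule: face_cases)
      case (first x' ys')
      then show ?thesis using ij by simp
    next
      case (inner us a b vs)
      show ?thesis
      proof (cases us)
        case Nil
        then have e: "xs = a # b # vs" "i = 0" "j = 1" "ys = b # vs" using first inner by simp_all
        then have "face_list xs j = diag_comp a b # vs" "face_coeff \<delta> xs j = \<delta> ^ closed_loops a b"
          using face_inner[of xs "[]" a b vs j] by simp_all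
        then show ?thesis using xs(1) eps_diag_comp[of a n b \<delta>] unfolding e
          by (simp add: face_0)
      next
        case (Cons c us')
        then have [simp]: "c = x" "ys = us' @ a # b # vs" using first inner by auto
        have "face_list xs j = x # us' @ diag_comp a b # vs" "face_coeff \<delta> xs j = \<delta> ^ closed_loops a b"
          using face_inner[OF inner] Cons by simp_all
        moreover have "face_list ys (j - 1) = us' @ diag_comp a b # vs" "face_coeff \<delta> ys (j - 1) = \<delta> ^ closed_loops a b"
          using face_inner[of ys us' a b vs "j - 1"] inner Cons by simp_all
        ultimately show ?thesis using first by (simp add: face_0 mult.commute)
      qed
    next
      case (last us a)
      then obtain us' where us: "us = x # us'" using first xs by (cases us) auto
      have "face_list xs j = x # us'" "face_coeff \<delta> xs j = eps a"
        using face_last[OF last] us by simp_all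
      moreover have "face_list ys (j - 1) = us'" "face_coeff \<delta> ys (j - 1) = eps a"
        using face_last[of ys us' a "j - 1"] last us first by simp_all
      ultimately show ?thesis using first by (simp add: face_0 mult.commute)
    qed
  next
    case (inner us x y vs)
    note f = face_inner[OF inner]
    have d: "x \<in> diagrams n" "y \<in> diagrams n" using xs(1) unfolding inner(1) by auto
    from ne ij(2) show ?thesis
    proof (cases rule: face_cases)
      case (first x' ys')
      then show ?thesis using ij by simp
    next
      case 2: (inner us' x' y' vs')
      note f' = face_inner[OF 2]
      have len: "length us < length us'" using 2(2) inner(2) ij by simp
      \<comment> \<open>Overlapping products share their middle factor; otherwise the product at
        \<open>i\<close> lies strictly to the left and only shifts the later position by
        one.\<close>
      show ?thesis
      proof (cases "length us' = Suc (length us)")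
        case True
        have us': "us' = us @ [x]" "x' = y" "vs = y' # vs'"
        proof -
          have "us @ x # y # vs = us' @ x' # y' # vs'" using 2(1) unfolding inner(1) .
          then have "(us @ [x]) @ y # vs = us' @ x' # y' # vs'" by simp
          then have "us @ [x] = us' \<and> y # vs = x' # y' # vs'" using True append_eq_append_conv[of "us @ [x]" us'] by simp
          then show "us' = us @ [x]" "x' = y" "vs = y' # vs'" by auto
        qed
        have d': "y' \<in> diagrams n" using xs(1) unfolding inner(1) us' by auto
        have 3: "face_list (us @ x # diag_comp y y' # vs') i = us @ diag_comp x (diag_comp y y') # vs'"
           "face_coeff \<delta> (us @ x # diag_comp y y' # vs') i = \<delta> ^ closed_loops x (diag_comp y y')"
          using face_inner[OF refl inner(2)] by blast+
        have 4: "face_list (us @ diag_comp x y # y' # vs') (j - 1) = us @ diag_comp (diag_comp x y) y' # vs'"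
           "face_coeff \<delta> (us @ diag_comp x y # y' # vs') (j - 1) = \<delta> ^ closed_loops (diag_comp x y) y'"
          using face_inner[of "us @ diag_comp x y # y' # vs'" us "diag_comp x y" y' vs' "j - 1"] 2(2) True by auto
        show ?thesis
          unfolding f f' us' append.assoc append_Cons append_Nil 3 4
          using diag_comp_assoc[OF d d'] by (simp add: power_add[symmetric])
      next
        case False
        then obtain ms where ms: "us' = us @ x # y # ms" "vs = ms @ x' # y' # vs'"
        proof -
          have eq: "us @ x # y # vs = us' @ x' # y' # vs'" using 2(1) unfolding inner(1) .
          have 1: "length (us @ [x, y]) \<le> length us'" using len False by simp
          have "us @ [x, y] = take (length us + 2) us'"
            using arg_cong[OF eq, of "take (length us + 2)"] 1 by simp
          then obtain ms where ms: "us' = us @ x # y # ms"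
            by (metis append.assoc append_Cons append_Nil append_take_drop_id)
          with eq have "vs = ms @ x' # y' # vs'" by simp
          with ms show ?thesis using that by blast
        qed
        have 3: "face_list (us @ x # y # ms @ diag_comp x' y' # vs') i = us @ diag_comp x y # ms @ diag_comp x' y' # vs'"
           "face_coeff \<delta> (us @ x # y # ms @ diag_comp x' y' # vs') i = \<delta> ^ closed_loops x y"
          using face_inner[OF refl inner(2)] by blast+
        have 4: "face_list (us @ diag_comp x y # ms @ x' # y' # vs') (j - 1) = us @ diag_comp x y # ms @ diag_comp x' y' # vs'"
           "face_coeff \<delta> (us @ diag_comp x y # ms @ x' # y' # vs') (j - 1) = \<delta> ^ closed_loops x' y'"
          using face_inner[of "us @ diag_comp x y # ms @ x' # y' # vs'" "us @ diag_comp x y # ms" x' y' vs' "j - 1"] 2(2) ms(1) by auto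
        show ?thesis
          unfolding f f' ms append.assoc append_Cons append_Nil 3 4 by (simp add: mult.commute)
      qed
    next
      case (last us' z)
      note f' = face_last[OF last]
      show ?thesis
      proof (cases vs rule: rev_cases)
        case Nil
        then have ab: "us' = us @ [x]" "z = y" using last(1) inner(1) by auto
        have 3: "face_list (us @ [x]) i = us" "face_coeff \<delta> (us @ [x]) i = eps x"
          using face_last[OF refl inner(2)] by blast+
        have 4: "face_list (us @ [diag_comp x y]) (j - 1) = us" "face_coeff \<delta> (us @ [diag_comp x y]) (j - 1) = eps (diag_comp x y)"
          using face_last[of "us @ [diag_comp x y]" us "diag_comp x y" "j - 1"] last(2) ab by auto
        show ?thesis
          unfolding f f' Nil ab 3 4
          using eps_diag_comp[OF d, of \<delta>] by (simp add: mult.commute)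
      next
        case (snoc ms w)
        then have ab: "us' = us @ x # y # ms" "z = w" using last(1) inner(1) by auto
        have 3: "face_list (us @ x # y # ms) i = us @ diag_comp x y # ms" "face_coeff \<delta> (us @ x # y # ms) i = \<delta> ^ closed_loops x y"
          using face_inner[OF refl inner(2)] by blast+
        have 4: "face_list (us @ diag_comp x y # ms @ [w]) (j - 1) = us @ diag_comp x y # ms" 
            "face_coeff \<delta> (us @ diag_comp x y # ms @ [w]) (j - 1) = eps w"
          using face_last[of "us @ diag_comp x y # ms @ [w]" "us @ diag_comp x y # ms" w "j - 1"] last(2) ab by auto
        show ?thesis
          unfolding f f' snoc ab 3 4 by (simp add: mult.commute)
      qed
    qed
  next
    case (last us x)
    then show ?thesis using ij by simp
  qed
qed

section \<open>The square of the differential\<close>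

lemma alternating_double_sum:
  fixes G :: "nat \<Rightarrow> nat \<Rightarrow> 'r::comm_ring_1"
  assumes "\<And>i j. i < j \<Longrightarrow> j \<le> Suc m \<Longrightarrow> G i j = G (j - 1) i"
  shows "(\<Sum>j\<le>Suc m. \<Sum>i\<le>m. (-1) ^ j * ((-1) ^ i * G i j)) = 0"
proof -
  let ?t = "\<lambda>(j, i). (-1) ^ j * ((-1) ^ i * G i j)"
  \<comment> \<open>The pair (j, i) with i < j cancels against (i, j - 1): equal values by the
    assumption, opposite signs since the index sum drops by one.\<close>
  let ?A = "{(j, i). i < j \<and> j \<le> Suc m}" and ?B = "{(j, i). j \<le> i \<and> i \<le> m}"
  have fin: "finite ?A" "finite ?B"
    by (rule finite_subset[of _ "{..Suc m} \<times> {..Suc m}"]; auto)+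
  have "(\<Sum>j\<le>Suc m. \<Sum>i\<le>m. (-1) ^ j * ((-1) ^ i * G i j)) = sum ?t ({..Suc m} \<times> {..m})"
    by (simp add: sum.cartesian_product)
  also have "{..Suc m} \<times> {..m} = ?A \<union> ?B" by auto
  also have "sum ?t (?A \<union> ?B) = sum ?t ?A + sum ?t ?B"
    by (rule sum.union_disjoint[OF fin]) auto
  also have "sum ?t ?A = (\<Sum>p\<in>?B. - ?t p)"
  proof (rule sum.reindex_bij_betw[symmetric, where h = "\<lambda>(j, i). (Suc i, j)", THEN trans])
    show "bij_betw (\<lambda>(j, i). (Suc i, j)) ?B ?A"
      by (rule bij_betw_byWitness[where f' = "\<lambda>(j, i). (i, j - 1)"]) auto
    show "(\<Sum>p\<in>?B. ?t ((\<lambda>(j, i). (Suc i, j)) p)) = (\<Sum>p\<in>?B. - ?t p)"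
      by (rule sum.cong) (auto simp: assms mult.left_commute)
  qed
  finally show ?thesis by (simp add: sum_negf)
qed

definition tuples :: "nat \<Rightarrow> nat \<Rightarrow> int set set list set" where
  "tuples n k = {xs. length xs = k \<and> set xs \<subseteq> diagrams n}"

definition supported :: "('a \<Rightarrow> 'r::zero) \<Rightarrow> 'a set \<Rightarrow> bool" where
  "supported c X \<longleftrightarrow> (\<forall>x. c x \<noteq> 0 \<longrightarrow> x \<in> X)"

lemma finite_tuples: "finite (tuples n k)"
  using finite_lists_length_eq[OF finite_diagrams, of n k] by (simp add: tuples_def conj_commute)

lemma bar_chains_diagrams: "c \<in> bar_chains (diagrams n) k \<longleftrightarrow> supported c (tuples n k)"
  by (simp add: bar_chains_def supported_def tuples_def)

lemma supported_mono: "supported c X \<Longrightarrow> X \<subseteq> Y \<Longrightarrow> supported c Y"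
  by (auto simp: supported_def)

lemma face_list_tuples:
  assumes "xs \<in> tuples n (Suc k)" "i \<le> Suc k"
  shows "face_list xs i \<in> tuples n k"
proof -
  have xs: "set xs \<subseteq> diagrams n" "length xs = Suc k" "xs \<noteq> []" using assms by (auto simp: tuples_def)
  have "i \<le> length xs" using assms(2) xs by simp
  with xs(3) show ?thesis
  proof (cases rule: face_cases)
    case (first x ys)
    then show ?thesis using xs by (simp add: face_0 tuples_def)
  next
    case (inner us x y vs)
    show ?thesis using xs(1,2) inner(1) unfolding tuples_def face_inner[OF inner] by (auto simp: diag_comp_diagrams)
  next
    case (last us x)
    show ?thesis using xs(1,2) last(1) unfolding tuples_def face_last[OF last] by auto
  qed
qed

lemma bar_d_basis_eq:
  assumes "xs \<noteq> []"
  shows "bar_d_basis \<delta> xs ys = (\<Sum>i\<le>length xs. (-1) ^ i * bar_face \<delta> xs i ys)"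
  using assms by (simp add: bar_d_basis_def atLeast0AtMost)

lemma bar_d_basis_nonzeroE:
  assumes "bar_d_basis \<delta> xs ys \<noteq> 0"
  obtains i where "xs \<noteq> []" "i \<le> length xs" "ys = face_list xs i" "face_coeff \<delta> xs i \<noteq> 0"
proof -
  have ne: "xs \<noteq> []" using assms by (auto simp: bar_d_basis_def)
  have "\<exists>i\<in>{..length xs}. (-1) ^ i * bar_face \<delta> xs i ys \<noteq> 0"
    using assms unfolding bar_d_basis_eq[OF ne] by (meson sum.neutral)
  then obtain i where "i \<le> length xs" "(-1) ^ i * bar_face \<delta> xs i ys \<noteq> 0" by blast
  then have "bar_face \<delta> xs i ys \<noteq> 0" by (metis mult_zero_right)
  then show ?thesis using that[OF ne \<open>i \<le> length xs\<close>] by (auto simp: bar_face_eq single_def split: if_splits)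
qed

text \<open>\<open>bar_d\<close> sums over the support of its argument, which varies from chain to
  chain. Summing over a fixed finite superset instead makes the differential visibly linear.\<close>

lemma bar_d_eq:
  assumes "finite X" "supported c X"
  shows "bar_d \<delta> c ys = (\<Sum>xs\<in>X. c xs * bar_d_basis \<delta> xs ys)"
  unfolding bar_d_def
  by (rule sum.mono_neutral_left) (use assms in \<open>auto simp: supported_def\<close>)

lemma bar_d_supported:
  assumes "finite X" "supported c X"
    and "\<And>xs ys. xs \<in> X \<Longrightarrow> bar_d_basis \<delta> xs ys \<noteq> 0 \<Longrightarrow> ys \<in> Y"
  shows "supported (bar_d \<delta> c) Y"
  unfolding supported_def
proof (intro allI impI)
  fix ys assume "bar_d \<delta> c ys \<noteq> 0"
  then obtain xs where "xs \<in> X" "c xs * bar_d_basis \<delta> xs ys \<noteq> 0"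
    unfolding bar_d_eq[OF assms(1,2)] by (meson sum.neutral)
  then show "ys \<in> Y" using assms(3)[of xs ys] by (metis mult_zero_right)
qed

lemma bar_d_basis_tuples:
  assumes "xs \<in> tuples n (Suc k)" "bar_d_basis \<delta> xs ys \<noteq> 0"
  shows "ys \<in> tuples n k"
proof -
  obtain i where "i \<le> length xs" "ys = face_list xs i"
    using bar_d_basis_nonzeroE[OF assms(2)] by metis
  then show ?thesis using face_list_tuples[OF assms(1)] assms(1) by (simp add: tuples_def)
qed

lemma bar_d_tuples:
  "supported c (tuples n (Suc k)) \<Longrightarrow> supported (bar_d \<delta> c) (tuples n k)"
  using bar_d_supported[OF finite_tuples] bar_d_basis_tuples by blast

lemma sum_single:
  fixes r :: "'r::comm_ring_1"
  assumes "finite X" "a \<in> X"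
  shows "(\<Sum>x\<in>X. single a r x * f x) = r * f a"
proof -
  have "(\<Sum>x\<in>X. single a r x * f x) = (\<Sum>x\<in>X. if x = a then r * f x else 0)"
    by (rule sum.cong) (auto simp: single_def)
  then show ?thesis using assms by simp
qed

lemma bar_d_basis_twice:
  fixes \<delta> :: "'r::comm_ring_1"
  assumes xs: "xs \<in> tuples n (Suc k)"
  shows "(\<Sum>zs\<in>tuples n k. bar_d_basis \<delta> xs zs * bar_d_basis \<delta> zs ys) = 0"
proof (cases k)
  \<comment> \<open>Only the empty tuple occurs in degree 0, and its differential is 0 by
    convention: the complex is not augmented.\<close>
  case 0
  then show ?thesis by (simp add: tuples_def bar_d_basis_def)
next
  case (Suc m)
  have len: "length xs = Suc k" "xs \<noteq> []" "set xs \<subseteq> diagrams n" using xs by (auto simp: tuples_def)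
  let ?G = "\<lambda>i j. face_coeff \<delta> xs j * bar_face \<delta> (face_list xs j) i ys"
  have "(\<Sum>zs\<in>tuples n k. bar_d_basis \<delta> xs zs * bar_d_basis \<delta> zs ys) =
      (\<Sum>j\<le>Suc k. \<Sum>zs\<in>tuples n k. (-1) ^ j * (single (face_list xs j) (face_coeff \<delta> xs j) zs * bar_d_basis \<delta> zs ys))"
    unfolding bar_d_basis_eq[OF len(2)] len(1) sum_distrib_right bar_face_eq mult.assoc by (rule sum.swap)
  also have "\<dots> = (\<Sum>j\<le>Suc k. (-1) ^ j * (face_coeff \<delta> xs j * bar_d_basis \<delta> (face_list xs j) ys))"
    unfolding sum_distrib_left[symmetric]
    by (intro sum.cong refl arg_cong2[where f = "(*)"] sum_single finite_tuples face_list_tuples[OF xs]) simp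
  also have "\<dots> = (\<Sum>j\<le>Suc k. \<Sum>i\<le>k. (-1) ^ j * ((-1) ^ i * ?G i j))"
  proof (rule sum.cong[OF refl])
    fix j assume "j \<in> {..Suc k}"
    then have "face_list xs j \<in> tuples n k" using face_list_tuples[OF xs] by simp
    then have "length (face_list xs j) = k" "face_list xs j \<noteq> []" using Suc by (auto simp: tuples_def)
    then show "(-1) ^ j * (face_coeff \<delta> xs j * bar_d_basis \<delta> (face_list xs j) ys) = (\<Sum>i\<le>k. (-1) ^ j * ((-1) ^ i * ?G i j))"
      by (simp add: bar_d_basis_eq sum_distrib_left mult.left_commute)
  qed
  also have "\<dots> = 0"
  proof (rule alternating_double_sum)
    fix i j :: nat assume "i < j" "j \<le> Suc k"
    then have "face_list (face_list xs j) i = face_list (face_list xs i) (j - 1) \<and>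
      face_coeff \<delta> xs j * face_coeff \<delta> (face_list xs j) i =
      face_coeff \<delta> xs i * face_coeff \<delta> (face_list xs i) (j - 1)"
      using face_face[OF len(3)] len(1) Suc by simp
    then show "?G i j = ?G (j - 1) i" by (auto simp: bar_face_eq single_def)
  qed
  finally show ?thesis .
qed

lemma bar_d_bar_d:
  assumes c: "supported c (tuples n (Suc k))"
  shows "bar_d \<delta> (bar_d \<delta> c) = (\<lambda>_. 0)"
proof
  fix ys
  have "bar_d \<delta> (bar_d \<delta> c) ys = (\<Sum>zs\<in>tuples n k. (\<Sum>xs\<in>tuples n (Suc k). c xs * bar_d_basis \<delta> xs zs) * bar_d_basis \<delta> zs ys)"
    unfolding bar_d_eq[OF finite_tuples bar_d_tuples[OF c]] bar_d_eq[OF finite_tuples c] ..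
  also have "\<dots> = (\<Sum>xs\<in>tuples n (Suc k). c xs * (\<Sum>zs\<in>tuples n k. bar_d_basis \<delta> xs zs * bar_d_basis \<delta> zs ys))"
    unfolding sum_distrib_right sum_distrib_left mult.assoc by (rule sum.swap)
  also have "\<dots> = 0" by (simp add: bar_d_basis_twice)
  finally show "bar_d \<delta> (bar_d \<delta> c) ys = 0" .
qed

section \<open>Linearity of supports and of the differential\<close>

lemma supported_add: "supported a X \<Longrightarrow> supported b X \<Longrightarrow> supported (\<lambda>x. a x + b x :: 'r::comm_ring_1) X"
  unfolding supported_def by (metis add_0)

lemma supported_diff: "supported a X \<Longrightarrow> supported b X \<Longrightarrow> supported (\<lambda>x. a x - b x :: 'r::comm_ring_1) X"
  unfolding supported_def by (metis diff_0_right)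

lemma supported_scale: "supported a X \<Longrightarrow> supported (\<lambda>x. r * a x :: 'r::comm_ring_1) X"
  unfolding supported_def by (metis mult_zero_right)

lemma supported_sum: "(\<And>i. i \<in> I \<Longrightarrow> supported (a i) X) \<Longrightarrow> supported (\<lambda>x. \<Sum>i\<in>I. a i x :: 'r::comm_ring_1) X"
  unfolding supported_def by (meson sum.neutral)

lemma supported_zero: "supported (\<lambda>_. 0) X"
  by (simp add: supported_def)

context
  fixes X :: "int set set list set" and \<delta> :: "'r::comm_ring_1"
  assumes X: "finite X"
begin

lemma bar_d_add:
  "supported a X \<Longrightarrow> supported b X \<Longrightarrow> bar_d \<delta> (\<lambda>x. a x + b x) = (\<lambda>y. bar_d \<delta> a y + bar_d \<delta> b y)"
  by (simp add: fun_eq_iff bar_d_eq[OF X] supported_add distrib_right sum.distrib)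

lemma bar_d_diff:
  "supported a X \<Longrightarrow> supported b X \<Longrightarrow> bar_d \<delta> (\<lambda>x. a x - b x) = (\<lambda>y. bar_d \<delta> a y - bar_d \<delta> b y)"
  by (simp add: fun_eq_iff bar_d_eq[OF X] supported_diff left_diff_distrib sum_subtractf)

lemma bar_d_scale:
  "supported a X \<Longrightarrow> bar_d \<delta> (\<lambda>x. r * a x) = (\<lambda>y. r * bar_d \<delta> a y)"
  by (simp add: fun_eq_iff bar_d_eq[OF X] supported_scale sum_distrib_left mult.assoc)

lemma bar_d_sum:
  "(\<And>i. i \<in> I \<Longrightarrow> supported (a i) X) \<Longrightarrow> bar_d \<delta> (\<lambda>x. \<Sum>i\<in>I. a i x) = (\<lambda>y. \<Sum>i\<in>I. bar_d \<delta> (a i) y)"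
  unfolding fun_eq_iff
proof
  fix y assume a: "\<And>i. i \<in> I \<Longrightarrow> supported (a i) X"
  have "bar_d \<delta> (\<lambda>x. \<Sum>i\<in>I. a i x) y = (\<Sum>x\<in>X. \<Sum>i\<in>I. a i x * bar_d_basis \<delta> x y)"
    using a by (simp add: bar_d_eq[OF X] supported_sum sum_distrib_right)
  also have "\<dots> = (\<Sum>i\<in>I. \<Sum>x\<in>X. a i x * bar_d_basis \<delta> x y)"
    by (rule sum.swap)
  also have "\<dots> = (\<Sum>i\<in>I. bar_d \<delta> (a i) y)"
    using a by (simp add: bar_d_eq[OF X])
  finally show "bar_d \<delta> (\<lambda>x. \<Sum>i\<in>I. a i x) y = (\<Sum>i\<in>I. bar_d \<delta> (a i) y)" .
qed

end

lemma bar_d_zero: "bar_d \<delta> (\<lambda>_. 0) = (\<lambda>_. 0)"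
  by (simp add: bar_d_def)

section \<open>Tuples ending in a non-permutation diagram\<close>

text \<open>The tensor product of the chain \<open>c\<close> with the basis tuple \<open>s\<close>,
  as a coefficient function.\<close>

definition append_tail :: "'a list \<Rightarrow> ('a list \<Rightarrow> 'r) \<Rightarrow> 'a list \<Rightarrow> 'r::zero" where
  "append_tail s c ys = (if length s \<le> length ys \<and> drop (length ys - length s) ys = s
     then c (take (length ys - length s) ys) else 0)"

lemma append_tail_append: "append_tail s c (ps @ s) = c ps"
  by (simp add: append_tail_def)

lemma append_tail_nonzeroE:
  assumes "append_tail s c ys \<noteq> 0"
  obtains ps where "ys = ps @ s" "c ps \<noteq> 0"
  using assms append_take_drop_id[of "length ys - length s" ys]
  unfolding append_tail_def by (metis)

lemma append_tail_single: "append_tail s (single a r) = single (a @ s) r"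
proof
  fix ys show "append_tail s (single a r) ys = single (a @ s) r ys"
  proof (cases "\<exists>ps. ys = ps @ s")
    case True
    then obtain ps where "ys = ps @ s" by blast
    then show ?thesis by (simp add: append_tail_append single_def)
  next
    case False
    then have "append_tail s (single a r) ys = 0" by (metis append_tail_nonzeroE)
    with False show ?thesis by (auto simp: single_def)
  qed
qed

lemma append_tail_sum:
  "append_tail s (\<lambda>y. \<Sum>i\<in>I. f i * g i y) ys = (\<Sum>i\<in>I. f i * append_tail s (g i) ys :: 'r::comm_ring_1)"
proof (cases "length s \<le> length ys \<and> drop (length ys - length s) ys = s")
  case False
  then have "append_tail s c ys = (0 :: 'r)" for c unfolding append_tail_def by (rule if_not_P)
  then show ?thesis by simp
qed (simp add: append_tail_def)

lemma append_tail_zero: "append_tail s (\<lambda>_. 0) = (\<lambda>_. 0)"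
  by (simp add: append_tail_def fun_eq_iff)

lemma append_tail_supported:
  assumes "supported c X"
  shows "supported (append_tail s c) ((\<lambda>xs. xs @ s) ` X)"
  unfolding supported_def
proof (intro allI impI)
  fix ys assume "append_tail s c ys \<noteq> 0"
  then obtain ps where "ys = ps @ s" "c ps \<noteq> 0" by (rule append_tail_nonzeroE)
  then show "ys \<in> (\<lambda>xs. xs @ s) ` X" using assms by (auto simp: supported_def)
qed

lemma bar_d_append_tail:
  assumes "finite X" "supported c X"
  shows "bar_d \<delta> (append_tail s c) ys = (\<Sum>xs\<in>X. c xs * bar_d_basis \<delta> (xs @ s) ys)"
proof -
  have "bar_d \<delta> (append_tail s c) ys = (\<Sum>zs\<in>(\<lambda>xs. xs @ s) ` X. append_tail s c zs * bar_d_basis \<delta> zs ys)"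
    by (rule bar_d_eq) (use assms append_tail_supported in auto)
  also have "\<dots> = (\<Sum>xs\<in>X. append_tail s c (xs @ s) * bar_d_basis \<delta> (xs @ s) ys)"
    by (subst sum.reindex) (auto simp: inj_on_def)
  finally show ?thesis by (simp add: append_tail_append)
qed

abbreviation nonperm :: "nat \<Rightarrow> int set set set" where
  "nonperm n \<equiv> diagrams n - perm_diagrams n"

definition tuples_ending_in :: "nat \<Rightarrow> int set set set \<Rightarrow> nat \<Rightarrow> int set set list set" where
  "tuples_ending_in n M k = {xs \<in> tuples n k. xs \<noteq> [] \<and> last xs \<in> M}"

lemma finite_tuples_ending_in: "finite (tuples_ending_in n M k)"
  by (simp add: tuples_ending_in_def finite_tuples)

lemma tuples_ending_in_subset: "tuples_ending_in n M k \<subseteq> tuples n k"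
  by (auto simp: tuples_ending_in_def)

lemma tuples_ending_in_0: "tuples_ending_in n M 0 = {}"
  by (auto simp: tuples_ending_in_def tuples_def)

text \<open>The trailing face of a tuple ending in a non-permutation diagram vanishes, so that
  appending entries only adds new faces and leaves the old ones as they are.\<close>

lemma bar_d_basis_ending:
  fixes \<delta> :: "'r::comm_ring_1"
  assumes "xs \<in> tuples_ending_in n (nonperm n) k"
  shows "bar_d_basis \<delta> xs ys = (\<Sum>i<k. (-1) ^ i * bar_face \<delta> xs i ys)"
proof -
  have xs: "xs \<noteq> []" "length xs = k" "last xs \<in> nonperm n" "k \<noteq> 0"
    using assms by (auto simp: tuples_ending_in_def tuples_def)
  then have "eps (last xs) = (0 :: 'r)" by (simp add: eps_diagram[of _ n])
  then have "bar_face \<delta> xs k ys = 0"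
    using xs by (simp add: bar_face_def single_def)
  moreover have "{..k} = insert k {..<k}" by auto
  ultimately show ?thesis by (simp add: bar_d_basis_eq[OF xs(1)] xs(2))
qed

lemma bar_d_basis_append:
  fixes \<delta> :: "'r::comm_ring_1"
  assumes xs: "xs \<in> tuples_ending_in n (nonperm n) k"
  shows "bar_d_basis \<delta> (xs @ s) ys =
    append_tail s (bar_d_basis \<delta> xs) ys + (\<Sum>i=k..k + length s. (-1) ^ i * bar_face \<delta> (xs @ s) i ys)"
proof -
  have len: "xs \<noteq> []" "length xs = k" using xs by (auto simp: tuples_ending_in_def tuples_def)
  have face: "bar_face \<delta> (xs @ s) i = append_tail s (bar_face \<delta> xs i)" if i: "i < k" for i
  proof -
    have i': "i \<le> length xs" using i len by simp
    from len(1) i' have "face_list (xs @ s) i = face_list xs i @ s \<and> face_coeff \<delta> (xs @ s) i = face_coeff \<delta> xs i"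
    proof (cases rule: face_cases)
      case (first x ys)
      then show ?thesis by (simp add: face_0)
    next
      case (inner us x y vs)
      have "xs @ s = us @ x # y # vs @ s" using inner by simp
      note f = face_inner[OF this inner(2)]
      show ?thesis unfolding f face_inner[OF inner] by simp
    next
      case (last us x)
      then show ?thesis using i len by simp
    qed
    then show ?thesis by (simp add: bar_face_eq append_tail_single)
  qed
  \<comment> \<open>Position \<open>k\<close> starts the new faces: it multiplies the last entry of
    \<open>xs\<close> by the first entry of \<open>s\<close>, or is the augmentation face when
    \<open>s\<close> is empty.\<close>
  have "{..k + length s} = {..<k} \<union> {k..k + length s}" by auto
  then have "bar_d_basis \<delta> (xs @ s) ys = (\<Sum>i<k. (-1) ^ i * bar_face \<delta> (xs @ s) i ys) +
      (\<Sum>i=k..k + length s. (-1) ^ i * bar_face \<delta> (xs @ s) i ys)"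
    using len by (subst bar_d_basis_eq) (auto intro!: sum.union_disjoint)
  also have "(\<Sum>i<k. (-1) ^ i * bar_face \<delta> (xs @ s) i ys) = append_tail s (\<lambda>y. \<Sum>i<k. (-1) ^ i * bar_face \<delta> xs i y) ys"
    unfolding append_tail_sum by (rule sum.cong) (simp_all add: face)
  also have "\<dots> = append_tail s (bar_d_basis \<delta> xs) ys"
    using bar_d_basis_ending[OF xs, of \<delta>] by (metis (no_types, lifting) ext)
  finally show ?thesis .
qed

section \<open>Subcomplexes attached to left ideals\<close>

definition left_closed :: "nat \<Rightarrow> int set set set \<Rightarrow> bool" where
  "left_closed n M \<longleftrightarrow> M \<subseteq> nonperm n \<and> (\<forall>a\<in>diagrams n. \<forall>z\<in>M. diag_comp a z \<in> M)"

lemma left_closed_nonperm: "left_closed n (nonperm n)"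
  by (auto simp: left_closed_def diag_comp_diagrams diag_comp_perm_iff)

lemma tuples_ending_in_mono: "M \<subseteq> M' \<Longrightarrow> tuples_ending_in n M k \<subseteq> tuples_ending_in n M' k"
  by (auto simp: tuples_ending_in_def)

text \<open>A face with nonzero coefficient leaves the last entry alone or multiplies it from the
  left. The final face, and the initial face of a tuple of length one, would remove that entry, but
  their coefficient is the augmentation of a non-permutation diagram.\<close>

lemma bar_d_basis_tuples_ending_in:
  fixes \<delta> :: "'r::comm_ring_1"
  assumes M: "left_closed n M" and xs: "xs \<in> tuples_ending_in n M (Suc k)" and nz: "bar_d_basis \<delta> xs ys \<noteq> 0"
  shows "ys \<in> tuples_ending_in n M k"
proof -
  have x: "xs \<in> tuples n (Suc k)" "last xs \<in> M" "set xs \<subseteq> diagrams n" "length xs = Suc k"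
    using xs by (auto simp: tuples_ending_in_def tuples_def)
  have yt: "ys \<in> tuples n k" using bar_d_basis_tuples[OF x(1) nz] .
  have eps0: "eps (last xs) = (0 :: 'r)" using x(2) M by (auto simp: left_closed_def eps_diagram[of _ n])
  obtain i where i: "xs \<noteq> []" "i \<le> length xs" "ys = face_list xs i" "face_coeff \<delta> xs i \<noteq> 0"
    using bar_d_basis_nonzeroE[OF nz] .
  from i(1,2) have "ys \<noteq> [] \<and> last ys \<in> M"
  proof (cases rule: face_cases)
    case (first x' zs)
    then have "eps x' \<noteq> (0 :: 'r)" "ys = zs" using i by (simp_all add: face_0)
    then show ?thesis using first eps0 x(2) by (cases zs) auto
  next
    case (inner us a b vs)
    have "a \<in> diagrams n" using x(3) unfolding inner(1) by auto
    moreover have "ys = us @ diag_comp a b # vs" using i(3) face_inner(1)[OF inner] by simp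
    moreover have "last (us @ a # b # vs) \<in> M" using x(2) unfolding inner(1) .
    ultimately show ?thesis
      using M by (cases vs) (auto simp: left_closed_def)
  next
    case (last us a)
    then show ?thesis using i(4) eps0 face_last(2)[OF last, of \<delta>] by simp
  qed
  with yt show ?thesis by (simp add: tuples_ending_in_def)
qed

lemma bar_d_tuples_ending_in:
  assumes "left_closed n M" "supported c (tuples_ending_in n M (Suc k))"
  shows "supported (bar_d \<delta> c) (tuples_ending_in n M k)"
  using bar_d_supported[OF finite_tuples_ending_in assms(2)] bar_d_basis_tuples_ending_in[OF assms(1)] by blast

definition acyclic_ending :: "'r::comm_ring_1 \<Rightarrow> nat \<Rightarrow> int set set set \<Rightarrow> bool" where
  "acyclic_ending \<delta> n M \<longleftrightarrow> (\<forall>k c. supported c (tuples_ending_in n M k) \<longrightarrow> bar_d \<delta> c = (\<lambda>_. 0) \<longrightarrow>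
     (\<exists>v. supported v (tuples_ending_in n M (Suc k)) \<and> bar_d \<delta> v = c))"

lemma acyclic_endingE:
  assumes "acyclic_ending \<delta> n M" "supported c (tuples_ending_in n M k)" "bar_d \<delta> c = (\<lambda>_. 0)"
  obtains v where "supported v (tuples_ending_in n M (Suc k))" "bar_d \<delta> v = c"
  using assms unfolding acyclic_ending_def by blast

lemma supported_empty: "supported c {} \<longleftrightarrow> c = (\<lambda>_. 0)"
  by (auto simp: supported_def)

lemma acyclic_ending_empty: "acyclic_ending \<delta> n {}"
proof -
  have "tuples_ending_in n {} k = {}" for k by (auto simp: tuples_ending_in_def)
  then show ?thesis by (auto simp: acyclic_ending_def supported_empty bar_d_zero)
qed

text \<open>For a cycle c in degree k, the differential of c tensor e is (-1)^k \<delta>^u c: the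
  old faces add up to (d c) tensor e = 0, the face joining c to e multiplies by \<delta>^u because z
  e = \<delta>^u z for the last entry z, and the final face has coefficient 0. Scaling by (-1)^k and
  by the inverse of \<delta>^u gives a primitive.\<close>

lemma acyclic_right_ideal_cell:
  fixes \<delta> :: "'r::comm_ring_1"
  assumes \<delta>: "\<delta> dvd 1" and y: "y \<in> nonperm n"
  shows "acyclic_ending \<delta> n (right_ideal_cell n y)"
  unfolding acyclic_ending_def
proof (intro allI impI)
  fix k and c :: "int set set list \<Rightarrow> 'r"
  let ?M = "right_ideal_cell n y" and ?e = "right_idempotent n y"
  let ?X = "tuples_ending_in n ?M k" and ?u = "card (right_singletons y n)"
  assume c: "supported c ?X" and cyc: "bar_d \<delta> c = (\<lambda>_. 0)"
  have yd: "y \<in> diagrams n" "y \<notin> perm_diagrams n" using y by auto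
  note e = right_idempotent_in_cell[OF yd]
  have Msub: "?M \<subseteq> nonperm n" by (auto simp: right_ideal_cell_def)
  have ed: "?e \<in> nonperm n" using e Msub by blast
  have basis: "bar_d_basis \<delta> (xs @ [?e]) ys = append_tail [?e] (bar_d_basis \<delta> xs) ys + (-1) ^ k * \<delta> ^ ?u * single xs 1 ys"
    if xs: "xs \<in> ?X" for xs ys
  proof -
    have xs': "xs \<in> tuples_ending_in n (nonperm n) k" using xs tuples_ending_in_mono[OF Msub] by blast
    have "xs \<noteq> []" "length xs = k" "last xs \<in> ?M" using xs by (auto simp: tuples_ending_in_def tuples_def)
    then obtain us z where us: "xs = us @ [z]" "z \<in> ?M" "k = Suc (length us)"
      by (cases xs rule: rev_cases) auto
    have "bar_face \<delta> (xs @ [?e]) k ys = \<delta> ^ ?u * single xs 1 ys"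
    proof -
      have "xs @ [?e] = us @ z # ?e # []" using us by simp
      note f = face_inner[OF this us(3)]
      then show ?thesis
        unfolding bar_face_eq f diag_comp_right_idempotent[OF yd(1) us(2)] by (simp add: single_def us(1))
    qed
    moreover have "bar_face \<delta> (xs @ [?e]) (Suc k) ys = 0"
    proof -
      have "Suc k = Suc (length xs)" using us by simp
      note f = face_last[OF refl[of "xs @ [?e]"] this]
      show ?thesis
        unfolding bar_face_eq f using ed by (simp add: single_def eps_diagram[of _ n])
    qed
    ultimately show ?thesis
      unfolding bar_d_basis_append[OF xs'] by (simp add: mult.assoc)
  qed
  have "bar_d \<delta> (append_tail [?e] c) ys = (-1) ^ k * \<delta> ^ ?u * c ys" for ys
  proof -
    have "bar_d \<delta> (append_tail [?e] c) ys =
        (\<Sum>xs\<in>?X. c xs * append_tail [?e] (bar_d_basis \<delta> xs) ys + (-1) ^ k * \<delta> ^ ?u * (c xs * single xs 1 ys))"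
      unfolding bar_d_append_tail[OF finite_tuples_ending_in c]
      by (rule sum.cong) (simp_all add: basis algebra_simps)
    also have "\<dots> = append_tail [?e] (\<lambda>y. \<Sum>xs\<in>?X. c xs * bar_d_basis \<delta> xs y) ys +
        (-1) ^ k * \<delta> ^ ?u * (\<Sum>xs\<in>?X. c xs * single xs 1 ys)"
      unfolding append_tail_sum sum.distrib sum_distrib_left ..
    also have "(\<lambda>y. \<Sum>xs\<in>?X. c xs * bar_d_basis \<delta> xs y) = (\<lambda>_. 0)"
      using cyc bar_d_eq[OF finite_tuples_ending_in c, of \<delta>] by (simp add: fun_eq_iff)
    also have "(\<Sum>xs\<in>?X. c xs * single xs 1 ys) = (\<Sum>xs\<in>?X. if ys = xs then c xs else 0)"
      by (rule sum.cong) (auto simp: single_def)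
    also have "\<dots> = c ys"
      using c finite_tuples_ending_in[of n ?M k] by (auto simp: supported_def)
    finally show ?thesis by (simp add: append_tail_zero)
  qed
  note d = this
  obtain w where w: "1 = \<delta> * w" using \<delta> by (rule dvdE)
  let ?v = "\<lambda>xs. ((-1) ^ k * w ^ ?u) * append_tail [?e] c xs"
  let ?Y = "tuples_ending_in n ?M (Suc k)"
  have "(\<lambda>xs. xs @ [?e]) ` ?X \<subseteq> ?Y"
    using e ed by (auto simp: tuples_ending_in_def tuples_def)
  then have s: "supported (append_tail [?e] c) ?Y"
    using append_tail_supported[OF c] supported_mono by blast
  have "bar_d \<delta> ?v ys = c ys" for ys
  proof -
    have "bar_d \<delta> ?v ys = ((-1) ^ k * w ^ ?u) * ((-1) ^ k * \<delta> ^ ?u * c ys)"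
      by (simp only: bar_d_scale[OF finite_tuples_ending_in s] d)
    also have "\<dots> = ((-1) ^ k * (-1) ^ k) * (\<delta> * w) ^ ?u * c ys"
      by (simp only: power_mult_distrib mult_ac)
    also have "\<dots> = c ys" by (simp add: w[symmetric] flip: power_mult_distrib)
    finally show ?thesis .
  qed
  then show "\<exists>v. supported v ?Y \<and> bar_d \<delta> v = c"
    using supported_scale[OF s] by blast
qed

text \<open>Mayer-Vietoris on chains: split c = c1 + c2 along the two ideals. The differential of c1
  is minus that of c2, so it is a cycle supported on the intersection and bounds some v there; c1 -
  v and c2 + v are then cycles in the two subcomplexes.\<close>

lemma acyclic_ending_Un:
  fixes \<delta> :: "'r::comm_ring_1"
  assumes M: "left_closed n M1" "left_closed n M2"
    and ac: "acyclic_ending \<delta> n M1" "acyclic_ending \<delta> n M2" "acyclic_ending \<delta> n (M1 \<inter> M2)"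
  shows "acyclic_ending \<delta> n (M1 \<union> M2)"
  unfolding acyclic_ending_def
proof (intro allI impI)
  fix k and c :: "int set set list \<Rightarrow> 'r"
  let ?T = "tuples_ending_in n"
  assume c: "supported c (?T (M1 \<union> M2) k)" and cyc: "bar_d \<delta> c = (\<lambda>_. 0)"
  show "\<exists>v. supported v (?T (M1 \<union> M2) (Suc k)) \<and> bar_d \<delta> v = c"
  proof (cases k)
    case 0
    then show ?thesis using c
      by (auto simp: tuples_ending_in_0 supported_empty intro!: exI[of _ "\<lambda>_. 0"] bar_d_zero supported_zero)
  next
    case (Suc m)
    define c1 where "c1 xs = (if last xs \<in> M1 then c xs else 0)" for xs
    define c2 where "c2 xs = c xs - c1 xs" for xs
    have c1: "supported c1 (?T M1 k)" and c2: "supported c2 (?T M2 k)"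
      using c by (auto simp: supported_def c1_def c2_def tuples_ending_in_def)
    note t = supported_mono[OF _ tuples_ending_in_subset] and fT = finite_tuples
    have sum: "bar_d \<delta> c2 ys = - bar_d \<delta> c1 ys" for ys
      using bar_d_diff[OF fT t[OF c] t[OF c1], of \<delta>] cyc by (simp add: c2_def[abs_def])
    have w1: "supported (bar_d \<delta> c1) (?T M1 m)" and w2: "supported (bar_d \<delta> c2) (?T M2 m)"
      using bar_d_tuples_ending_in M c1 c2 Suc by blast+
    have w: "supported (bar_d \<delta> c1) (?T (M1 \<inter> M2) m)"
      using w1 w2 sum by (auto simp: supported_def tuples_ending_in_def)
    have "bar_d \<delta> (bar_d \<delta> c1) = (\<lambda>_. 0)"
      using bar_d_bar_d t[OF c1] Suc by blast
    then obtain v where v: "supported v (?T (M1 \<inter> M2) k)" "bar_d \<delta> v = bar_d \<delta> c1"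
      using acyclic_endingE[OF ac(3) w] Suc by blast
    have v1: "supported v (?T M1 k)" and v2: "supported v (?T M2 k)"
      using v(1) supported_mono tuples_ending_in_mono by (meson inf_le1 inf_le2)+
    have "bar_d \<delta> (\<lambda>x. c1 x - v x) = (\<lambda>_. 0)"
      by (simp add: bar_d_diff[OF fT t[OF c1] t[OF v1]] v(2))
    then obtain b1 where b1: "supported b1 (?T M1 (Suc k))" "bar_d \<delta> b1 = (\<lambda>x. c1 x - v x)"
      using acyclic_endingE[OF ac(1) supported_diff[OF c1 v1]] by blast
    have "bar_d \<delta> (\<lambda>x. c2 x + v x) = (\<lambda>_. 0)"
      by (simp add: bar_d_add[OF fT t[OF c2] t[OF v2]] v(2) sum)
    then obtain b2 where b2: "supported b2 (?T M2 (Suc k))" "bar_d \<delta> b2 = (\<lambda>x. c2 x + v x)"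
      using acyclic_endingE[OF ac(2) supported_add[OF c2 v2]] by blast
    have "bar_d \<delta> (\<lambda>x. b1 x + b2 x) = c"
      by (simp add: bar_d_add[OF fT t[OF b1(1)] t[OF b2(1)]] b1 b2 c2_def)
    moreover have "supported (\<lambda>x. b1 x + b2 x) (?T (M1 \<union> M2) (Suc k))"
      by (rule supported_add)
        (use b1 b2 supported_mono tuples_ending_in_mono in \<open>meson sup_ge1 sup_ge2\<close>)+
    ultimately show ?thesis by blast
  qed
qed

lemma right_ideal_cell_refl: "y \<in> nonperm n \<Longrightarrow> y \<in> right_ideal_cell n y"
  by (auto simp: right_ideal_cell_def)

lemma right_ideal_cell_trans: "z \<in> right_ideal_cell n y \<Longrightarrow> right_ideal_cell n z \<subseteq> right_ideal_cell n y"
  by (auto simp: right_ideal_cell_def)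

lemma right_ideal_cell_nonperm: "right_ideal_cell n y \<subseteq> nonperm n"
  by (auto simp: right_ideal_cell_def)

text \<open>The sets below are the open sets of the Alexandrov topology on the non-permutation diagrams
  in which the cells are the minimal neighbourhoods. Splitting off a maximal cell gives a
  Mayer-Vietoris argument.\<close>

lemma acyclic_open:
  fixes \<delta> :: "'r::comm_ring_1"
  assumes \<delta>: "\<delta> dvd 1"
  shows "Q \<subseteq> nonperm n \<Longrightarrow> (\<And>y. y \<in> Q \<Longrightarrow> right_ideal_cell n y \<subseteq> Q) \<Longrightarrow> acyclic_ending \<delta> n Q"
proof (induction "card Q" arbitrary: Q rule: less_induct)
  case less
  let ?cell = "right_ideal_cell n"
  have fin: "finite Q" using less.prems(1) finite_diagrams finite_subset by (metis finite_Diff)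
  have left_closed: "left_closed n P" if "P \<subseteq> nonperm n" "\<And>y. y \<in> P \<Longrightarrow> ?cell y \<subseteq> P" for P
    unfolding left_closed_def
    using that right_ideal_cell_left_ideal right_ideal_cell_refl by (meson subsetD)
  show ?case
  proof (cases "Q = {}")
    case True
    then show ?thesis by (simp add: acyclic_ending_empty)
  next
    case False
    \<comment> \<open>A cell of largest cardinality is contained in no strictly larger cell of
      \<open>Q\<close>, so deleting all points that generate it leaves an open set.\<close>
    then have "Max ((card \<circ> ?cell) ` Q) \<in> (card \<circ> ?cell) ` Q" using fin by (intro Max_in) auto
    then obtain y where y: "y \<in> Q" "(card \<circ> ?cell) y = Max ((card \<circ> ?cell) ` Q)" by auto
    have max: "card (?cell z) \<le> card (?cell y)" if "z \<in> Q" for z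
      using y(2) that fin by simp
    have yN: "y \<in> nonperm n" using y(1) less.prems(1) by blast
    \<comment> \<open>Different diagrams may generate the same cell, so points are removed by their
      cell and not just \<open>y\<close> alone.\<close>
    define P where "P = {z \<in> Q. ?cell z \<noteq> ?cell y}"
    have P: "?cell z \<subseteq> P" if z: "z \<in> P" for z
    proof
      fix w assume w: "w \<in> ?cell z"
      have zQ: "z \<in> Q" "?cell z \<noteq> ?cell y" using z by (auto simp: P_def)
      have "w \<in> Q" using w less.prems(2)[OF zQ(1)] by blast
      moreover have "?cell w \<noteq> ?cell y"
      proof
        assume "?cell w = ?cell y"
        then have "?cell y \<subseteq> ?cell z" using right_ideal_cell_trans[OF w] by simp
        moreover have "finite (?cell z)"
          using fin less.prems(2)[OF zQ(1)] finite_subset by blast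
        ultimately show False using max[OF zQ(1)] zQ(2) card_seteq by metis
      qed
      ultimately show "w \<in> P" by (simp add: P_def)
    qed
    have PQ: "P \<subseteq> Q" "y \<notin> P" by (auto simp: P_def)
    have cell: "?cell z \<subseteq> ?cell y" if "z \<in> ?cell y" for z using right_ideal_cell_trans[OF that] .
    have Q: "Q = ?cell y \<union> P"
    proof
      show "Q \<subseteq> ?cell y \<union> P"
        using right_ideal_cell_refl less.prems(1) by (auto simp: P_def)
      show "?cell y \<union> P \<subseteq> Q" using less.prems(2)[OF y(1)] PQ by blast
    qed
    \<comment> \<open>Both \<open>P\<close> and its intersection with the cell miss
      \<open>y\<close>, so the induction hypothesis covers the two remaining terms of
      Mayer-Vietoris.\<close>
    have smaller: "card S < card Q" if "S \<subseteq> P" for S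
      using that PQ y(1) fin by (intro psubset_card_mono) auto
    have "acyclic_ending \<delta> n P"
      by (rule less.hyps[OF smaller]) (use P PQ less.prems(1) in auto)
    moreover have "acyclic_ending \<delta> n (?cell y \<inter> P)"
    proof (rule less.hyps[OF smaller])
      show "?cell y \<inter> P \<subseteq> nonperm n" using PQ less.prems(1) by blast
      show "?cell z \<subseteq> ?cell y \<inter> P" if "z \<in> ?cell y \<inter> P" for z using that cell P by blast
    qed simp
    ultimately show ?thesis
      unfolding Q
      by (intro acyclic_ending_Un left_closed acyclic_right_ideal_cell[OF \<delta> yN])
        (use PQ less.prems(1) P cell right_ideal_cell_nonperm in blast)+
  qed
qed

lemma acyclic_nonperm:
  "\<delta> dvd 1 \<Longrightarrow> acyclic_ending \<delta> n (nonperm n)"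
  by (rule acyclic_open) (simp_all add: right_ideal_cell_nonperm)

section \<open>Trailing permutations\<close>

text \<open>Stage q of the filtration. The strict inequality makes stage 0 empty, and tails of
  length exactly q first appear in stage \<open>Suc q\<close>.\<close>

definition tail_tuples :: "nat \<Rightarrow> nat \<Rightarrow> nat \<Rightarrow> int set set list set" where
  "tail_tuples n q k = {xs \<in> tuples n k. \<exists>ps s. xs = ps @ s \<and> ps \<noteq> [] \<and> last ps \<in> nonperm n \<and>
     set s \<subseteq> perm_diagrams n \<and> length s < q}"

lemma finite_tail_tuples: "finite (tail_tuples n q k)"
  by (simp add: tail_tuples_def finite_tuples)

lemma tail_tuples_subset: "tail_tuples n q k \<subseteq> tuples n k"
  by (auto simp: tail_tuples_def)

lemma tail_tuples_mono: "q \<le> q' \<Longrightarrow> tail_tuples n q k \<subseteq> tail_tuples n q' k"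
  unfolding tail_tuples_def using less_le_trans by blast

lemma tail_tuplesI:
  "ps @ s \<in> tuples n k \<Longrightarrow> ps \<noteq> [] \<Longrightarrow> last ps \<in> nonperm n \<Longrightarrow> set s \<subseteq> perm_diagrams n \<Longrightarrow> length s < q
    \<Longrightarrow> ps @ s \<in> tail_tuples n q k"
  unfolding tail_tuples_def by blast

text \<open>Every face beyond those of \<open>ps\<close> shortens the tail of permutations: the
  first absorbs a permutation into the non-permutation entry before it, which remains a
  non-permutation; inner ones multiply two permutations; the final one drops a permutation. For an
  empty tail the only such face has coefficient 0. Hence, modulo a lower stage, the differential
  acts on \<open>ps\<close> alone.\<close>

lemma bar_d_basis_append_remainder:
  fixes \<delta> :: "'r::comm_ring_1"
  assumes ps: "ps \<in> tuples_ending_in n (nonperm n) m" and s: "set s \<subseteq> perm_diagrams n"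
    and len: "m + length s = Suc k"
    and ne: "bar_d_basis \<delta> (ps @ s) ys \<noteq> append_tail s (bar_d_basis \<delta> ps) ys"
  shows "ys \<in> tail_tuples n (length s) k"
proof -
  have p: "ps \<noteq> []" "length ps = m" "last ps \<in> nonperm n" "set ps \<subseteq> diagrams n" "m \<noteq> 0"
    using ps by (auto simp: tuples_ending_in_def tuples_def)
  have t: "ps @ s \<in> tuples n (Suc k)"
    using p s len perm_diagrams_subset by (auto simp: tuples_def)
  have "(\<Sum>i=m..m + length s. (-1) ^ i * bar_face \<delta> (ps @ s) i ys) \<noteq> 0"
    using ne unfolding bar_d_basis_append[OF ps] by auto
  then obtain i where i: "m \<le> i" "i \<le> m + length s" "(-1) ^ i * bar_face \<delta> (ps @ s) i ys \<noteq> 0"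
    by (meson atLeastAtMost_iff sum.neutral)
  then have "bar_face \<delta> (ps @ s) i ys \<noteq> 0" by (metis mult_zero_right)
  then have ys: "ys = face_list (ps @ s) i" and coeff: "face_coeff \<delta> (ps @ s) i \<noteq> 0"
    by (auto simp: bar_face_eq single_def split: if_splits)
  have yt: "ys \<in> tuples n k" using face_list_tuples[OF t] i len ys by simp
  obtain us z where us: "ps = us @ [z]" using p(1) by (cases ps rule: rev_cases) auto
  have z: "z \<in> nonperm n" using p(3) us by simp
  show ?thesis
  proof (cases "i = m")
    case True
    show ?thesis
    proof (cases s)
      case Nil
      have e: "ps @ s = us @ [z]" "i = Suc (length us)" using us p(2) True Nil by simp_all
      have "eps z = (0 :: 'r)" using z by (simp add: eps_diagram[of _ n])
      then show ?thesis using coeff unfolding face_last[OF e] by simp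
    next
      case (Cons x s')
      have e: "ps @ s = us @ z # x # s'" "i = Suc (length us)" using us p(2) True Cons by simp_all
      have y: "ys = (us @ [diag_comp z x]) @ s'" using ys unfolding face_inner[OF e] by simp
      have "x \<in> diagrams n" using s Cons perm_diagrams_subset by auto
      then have "diag_comp z x \<in> nonperm n"
        using z by (simp add: diag_comp_diagrams diag_comp_perm_iff)
      then show ?thesis
        using yt s Cons unfolding y by (intro tail_tuplesI) auto
    qed
  next
    case False
    show ?thesis
    proof (cases "i = m + length s")
      case True
      then have "s \<noteq> []" using False by auto
      then obtain s' x where s': "s = s' @ [x]" by (cases s rule: rev_cases) auto
      have e: "ps @ s = (ps @ s') @ [x]" "i = Suc (length (ps @ s'))" using s' True p(2) by simp_all
      show ?thesis
        using yt p(1,3) s s' unfolding ys face_last[OF e] by (intro tail_tuplesI) auto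
    next
      case 2: False
      have "0 < i - m" "i - m < length s" using i False 2 by simp_all
      then obtain vs a b ws where s': "s = vs @ a # b # ws" "i - m = Suc (length vs)"
        by (rule split_inner)
      have e: "ps @ s = (ps @ vs) @ a # b # ws" "i = Suc (length (ps @ vs))" using s' i p(2) by simp_all
      have y: "ys = ps @ (vs @ diag_comp a b # ws)" using ys unfolding face_inner[OF e] by simp
      have "a \<in> perm_diagrams n" "b \<in> perm_diagrams n" using s s' by auto
      then have "diag_comp a b \<in> perm_diagrams n"
        using diag_comp_perm_iff perm_diagrams_subset by blast
      then show ?thesis
        using yt p(1,3) s s' unfolding y by (intro tail_tuplesI) auto
    qed
  qed
qed

lemma bar_d_append_tail_remainder:
  fixes \<delta> :: "'r::comm_ring_1"
  assumes w: "supported w (tuples_ending_in n (nonperm n) m)" and s: "set s \<subseteq> perm_diagrams n"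
    and len: "m + length s = Suc k"
  shows "supported (\<lambda>ys. bar_d \<delta> (append_tail s w) ys - append_tail s (bar_d \<delta> w) ys) (tail_tuples n (length s) k)"
  unfolding supported_def
proof (intro allI impI)
  fix ys assume ne: "bar_d \<delta> (append_tail s w) ys - append_tail s (bar_d \<delta> w) ys \<noteq> 0"
  let ?X = "tuples_ending_in n (nonperm n) m"
  have "append_tail s (bar_d \<delta> w) ys = (\<Sum>xs\<in>?X. w xs * append_tail s (bar_d_basis \<delta> xs) ys)"
    unfolding append_tail_sum[symmetric] bar_d_eq[OF finite_tuples_ending_in w, abs_def] ..
  then have "(\<Sum>xs\<in>?X. w xs * (bar_d_basis \<delta> (xs @ s) ys - append_tail s (bar_d_basis \<delta> xs) ys)) \<noteq> 0"
    using ne by (simp add: bar_d_append_tail[OF finite_tuples_ending_in w] right_diff_distrib sum_subtractf)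
  then obtain xs where "xs \<in> ?X" "w xs * (bar_d_basis \<delta> (xs @ s) ys - append_tail s (bar_d_basis \<delta> xs) ys) \<noteq> 0"
    by (meson sum.neutral)
  then show "ys \<in> tail_tuples n (length s) k"
    using bar_d_basis_append_remainder[OF _ s len, of xs \<delta> ys] by (metis diff_self mult_zero_right)
qed

text \<open>Faces inside the prefix keep a non-permutation at its end and leave the tail as it is;
  all others shorten the tail. So each stage is a subcomplex.\<close>

lemma bar_d_tail_tuples:
  fixes \<delta> :: "'r::comm_ring_1"
  assumes c: "supported c (tail_tuples n q (Suc k))"
  shows "supported (bar_d \<delta> c) (tail_tuples n q k)"
proof (rule bar_d_supported[OF finite_tail_tuples c])
  fix xs ys assume xs: "xs \<in> tail_tuples n q (Suc k)" and nz: "bar_d_basis \<delta> xs ys \<noteq> 0"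
  then obtain ps s where ps: "xs = ps @ s" "ps \<noteq> []" "last ps \<in> nonperm n" "set s \<subseteq> perm_diagrams n" "length s < q"
    unfolding tail_tuples_def by blast
  have xt: "xs \<in> tuples n (Suc k)" using xs tail_tuples_subset by blast
  have len: "length ps + length s = Suc k" using xt ps(1) by (simp add: tuples_def)
  have pe: "ps \<in> tuples_ending_in n (nonperm n) (length ps)"
    using xt ps by (simp add: tuples_ending_in_def tuples_def)
  show "ys \<in> tail_tuples n q k"
  proof (cases "bar_d_basis \<delta> (ps @ s) ys = append_tail s (bar_d_basis \<delta> ps) ys")
    case True
    then have "append_tail s (bar_d_basis \<delta> ps) ys \<noteq> 0" using nz ps(1) by simp
    then obtain ps' where ps': "ys = ps' @ s" "bar_d_basis \<delta> ps ps' \<noteq> 0" by (rule append_tail_nonzeroE)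
    have "ps \<in> tuples_ending_in n (nonperm n) (Suc (length ps - 1))" using pe ps(2) by simp
    then have "ps' \<in> tuples_ending_in n (nonperm n) (length ps - 1)"
      using bar_d_basis_tuples_ending_in[OF left_closed_nonperm _ ps'(2)] by blast
    then show ?thesis
      using bar_d_basis_tuples[OF xt nz] ps(4,5) unfolding ps'(1)
      by (intro tail_tuplesI) (auto simp: tuples_ending_in_def)
  next
    case False
    then show ?thesis
      using bar_d_basis_append_remainder[OF pe ps(4) len False]
        tail_tuples_mono[of "length s" q n k] ps(5) by auto
  qed
qed

text \<open>The position of the last non-permutation entry determines the split, so the tail length
  is well defined.\<close>

lemma last_not_in_tail:
  assumes ps: "ps \<noteq> []" "last ps \<in> nonperm n" and s: "set s \<subseteq> perm_diagrams n"
  shows "ps @ s \<notin> tail_tuples n (length s) k"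
proof
  assume "ps @ s \<in> tail_tuples n (length s) k"
  then obtain ps' s' where p: "ps @ s = ps' @ s'" "length s' < length s" "last ps' \<in> nonperm n" "ps' \<noteq> []"
    unfolding tail_tuples_def by blast
  obtain t where "ps' = ps @ t" "s = t @ s'"
    using p(1,2) by (auto simp: append_eq_append_conv2)
  moreover from this have "t \<noteq> []" using p(2) by auto
  ultimately have "last ps' \<in> set s" by simp
  then show False using p(3) s by blast
qed

text \<open>The quotient of stage \<open>Suc q\<close> by stage \<open>q\<close> splits, over the
  tails of length \<open>q\<close>, into copies of the acyclic complex of tuples ending in a
  non-permutation diagram. The primitive is sought in the full complex; its stage is not tracked
  through the induction.\<close>

lemma acyclic_tail_tuples:
  fixes \<delta> :: "'r::comm_ring_1"
  assumes \<delta>: "\<delta> dvd 1"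
  shows "supported c (tail_tuples n q k) \<Longrightarrow> bar_d \<delta> c = (\<lambda>_. 0) \<Longrightarrow>
    \<exists>v. supported v (tuples n (Suc k)) \<and> bar_d \<delta> v = c"
proof (induction q arbitrary: c)
  case 0
  then have "c = (\<lambda>_. 0)" by (auto simp: tail_tuples_def supported_def)
  then show ?case using bar_d_zero supported_zero by blast
next
  case (Suc q)
  show ?case
  proof (cases "k \<le> q")
    \<comment> \<open>The prefix is nonempty, so tails are shorter than \<open>k\<close> and the
      filtration has already stabilised.\<close>
    case True
    have "tail_tuples n (Suc q) k \<subseteq> tail_tuples n q k"
    proof
      fix xs assume "xs \<in> tail_tuples n (Suc q) k"
      then obtain ps s where "xs = ps @ s" "ps @ s \<in> tuples n k" "ps \<noteq> []" "last ps \<in> nonperm n" "set s \<subseteq> perm_diagrams n"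
        unfolding tail_tuples_def by blast
      moreover from this have "length s < q" using True by (cases ps) (auto simp: tuples_def)
      ultimately show "xs \<in> tail_tuples n q k" by (simp add: tail_tuplesI)
    qed
    then show ?thesis using Suc supported_mono by blast
  next
    case False
    then obtain m where m: "k = Suc m + q" by (metis add.commute add_Suc_right less_imp_Suc_add not_le_imp_less)
    let ?N = "nonperm n"
    define S where "S = {s. set s \<subseteq> perm_diagrams n \<and> length s = q}"
    have "finite (perm_diagrams n)" using finite_diagrams perm_diagrams_subset finite_subset by blast
    then have finS: "finite S" unfolding S_def by (rule finite_lists_length_eq)
    \<comment> \<open>The part of \<open>c\<close> with tail exactly \<open>s\<close>, the tail
      being stripped off.\<close>
    define w where "w s ps = (if ps \<in> tuples_ending_in n ?N (Suc m) then c (ps @ s) else 0)" for s ps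
    have w: "supported (w s) (tuples_ending_in n ?N (Suc m))" for s
      by (simp add: w_def supported_def)
    have tS: "supported (append_tail s a) (tuples n (p + q))"
      if "s \<in> S" "supported a (tuples_ending_in n ?N p)" for s p and a :: "int set set list \<Rightarrow> 'r"
    proof (rule supported_mono[OF append_tail_supported[OF that(2)]])
      show "(\<lambda>xs. xs @ s) ` tuples_ending_in n ?N p \<subseteq> tuples n (p + q)"
      proof -
        have "set s \<subseteq> diagrams n" "length s = q" using that(1) perm_diagrams_subset by (auto simp: S_def)
        then show ?thesis by (auto simp: tuples_ending_in_def tuples_def)
      qed
    qed
    \<comment> \<open>Tails in \<open>S\<close> have equal length, so two different ones never end
      the same tuple.\<close>
    have at: "(\<Sum>s'\<in>S. append_tail s' (a s') (ps @ s)) = a s ps" if s: "s \<in> S" for s ps and a :: "_ \<Rightarrow> _ \<Rightarrow> 'r"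
    proof -
      have "append_tail s' (a s') (ps @ s) = (if s' = s then a s ps else 0)" if "s' \<in> S" for s'
      proof (cases "s' = s")
        case True
        then show ?thesis by (simp add: append_tail_append)
      next
        case False
        then have "append_tail s' (a s') (ps @ s) = 0"
          using s that by (auto simp: append_tail_def S_def)
        then show ?thesis using False by simp
      qed
      then have "(\<Sum>s'\<in>S. append_tail s' (a s') (ps @ s)) = (\<Sum>s'\<in>S. if s' = s then a s ps else 0)"
        by (rule sum.cong[OF refl])
      then show ?thesis using s finS by simp
    qed
    \<comment> \<open>What is left after removing all tails of length \<open>q\<close>; it lies in
      the lower stage.\<close>
    define c' where "c' xs = c xs - (\<Sum>s\<in>S. append_tail s (w s) xs)" for xs
    have sw: "supported (\<lambda>xs. \<Sum>s\<in>S. append_tail s (w s) xs) (tuples n k)"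
      by (rule supported_sum) (use tS[OF _ w] m in simp)
    have ct: "supported c (tuples n k)" using Suc.prems(1) supported_mono tail_tuples_subset by blast
    have c': "supported c' (tail_tuples n q k)"
      unfolding supported_def
    proof (intro allI impI)
      fix xs assume nz: "c' xs \<noteq> 0"
      have xt: "xs \<in> tuples n k" using supported_diff[OF ct sw] nz unfolding c'_def supported_def by blast
      show "xs \<in> tail_tuples n q k"
      proof (cases "\<exists>s\<in>S. \<exists>ps\<in>tuples_ending_in n ?N (Suc m). xs = ps @ s")
        case True
        then obtain s ps where s: "s \<in> S" and "ps \<in> tuples_ending_in n ?N (Suc m)" "xs = ps @ s" by blast
        then have "c' xs = 0" using at[OF s, of w ps] by (simp add: c'_def w_def)
        with nz show ?thesis by simp
      next
        case False
        have "append_tail s (w s) xs = 0" if "s \<in> S" for s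
        proof (rule ccontr)
          assume "append_tail s (w s) xs \<noteq> 0"
          then obtain ps where "xs = ps @ s" "w s ps \<noteq> 0" by (rule append_tail_nonzeroE)
          then show False using False that by (auto simp: w_def split: if_splits)
        qed
        then have "c xs \<noteq> 0" using nz by (simp add: c'_def)
        then have "xs \<in> tail_tuples n (Suc q) k" using Suc.prems(1) by (simp add: supported_def)
        then obtain ps s where ps: "xs = ps @ s" "ps \<noteq> []" "last ps \<in> ?N" "set s \<subseteq> perm_diagrams n" "length s \<le> q"
          unfolding tail_tuples_def by auto
        have "length s \<noteq> q"
        proof
          assume q: "length s = q"
          then have "ps \<in> tuples_ending_in n ?N (Suc m)"
            using xt ps m by (simp add: tuples_ending_in_def tuples_def)
          then show False using False ps q by (auto simp: S_def)
        qed
        then show ?thesis using xt ps by (simp add: tail_tuplesI)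
      qed
    qed
    have c'_t: "supported c' (tuples n k)" using c' supported_mono tail_tuples_subset by blast
    \<comment> \<open>Evaluate the vanishing differential of \<open>c\<close> at
      \<open>ps @ s\<close>. Neither \<open>c'\<close> nor the remainder terms reach a tuple whose
      tail has length exactly \<open>q\<close>, so only the differential of \<open>w s\<close> is
      left.\<close>
    have dw: "bar_d \<delta> (w s) = (\<lambda>_. 0)" if s: "s \<in> S" for s
    proof
      fix ps
      show "bar_d \<delta> (w s) ps = 0"
      proof (rule ccontr)
        assume nz: "bar_d \<delta> (w s) ps \<noteq> 0"
        have "supported (bar_d \<delta> (w s)) (tuples_ending_in n ?N m)"
          using bar_d_tuples_ending_in[OF left_closed_nonperm w] .
        then have "ps \<in> tuples_ending_in n ?N m" using nz by (simp add: supported_def)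
        then have ps: "ps \<noteq> []" "last ps \<in> ?N" by (auto simp: tuples_ending_in_def)
        have ql: "q = length s" and sp: "set s \<subseteq> perm_diagrams n" using s by (simp_all add: S_def)
        note nt = last_not_in_tail[OF ps sp, folded ql]
        have r: "bar_d \<delta> (append_tail s' (w s')) (ps @ s) = append_tail s' (bar_d \<delta> (w s')) (ps @ s)" if "s' \<in> S" for s'
          using bar_d_append_tail_remainder[OF w[of s'], where s = s' and k = "m + q" and \<delta> = \<delta>] that nt[of "m + q"]
          by (auto simp: S_def supported_def)
        have "c = (\<lambda>xs. c' xs + (\<Sum>s\<in>S. append_tail s (w s) xs))"
          by (simp add: c'_def)
        then have "bar_d \<delta> c = (\<lambda>y. bar_d \<delta> c' y + bar_d \<delta> (\<lambda>xs. \<Sum>s\<in>S. append_tail s (w s) xs) y)"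
          using bar_d_add[OF finite_tuples c'_t sw, of \<delta>] by simp
        also have "bar_d \<delta> (\<lambda>xs. \<Sum>s\<in>S. append_tail s (w s) xs) = (\<lambda>y. \<Sum>s\<in>S. bar_d \<delta> (append_tail s (w s)) y)"
          by (rule bar_d_sum[OF finite_tuples[of n k]]) (use tS[OF _ w] m in simp)
        finally have "0 = bar_d \<delta> c' (ps @ s) + (\<Sum>s'\<in>S. bar_d \<delta> (append_tail s' (w s')) (ps @ s))"
          using Suc.prems(2) by (metis)
        also have "bar_d \<delta> c' (ps @ s) = 0"
          using bar_d_tail_tuples[of c' n q "m + q" \<delta>] c' nt[of "m + q"] m by (auto simp: supported_def)
        also have "(\<Sum>s'\<in>S. bar_d \<delta> (append_tail s' (w s')) (ps @ s)) = (\<Sum>s'\<in>S. append_tail s' (bar_d \<delta> (w s')) (ps @ s))"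
          by (rule sum.cong[OF refl r])
        also have "\<dots> = bar_d \<delta> (w s) ps" by (rule at[OF s])
        finally show False using nz by simp
      qed
    qed
    have "\<forall>s\<in>S. \<exists>v. supported v (tuples_ending_in n ?N (Suc (Suc m))) \<and> bar_d \<delta> v = w s"
      using acyclic_endingE[OF acyclic_nonperm[OF \<delta>] w dw] by metis
    then obtain v where v: "\<And>s. s \<in> S \<Longrightarrow> supported (v s) (tuples_ending_in n ?N (Suc (Suc m)))"
      "\<And>s. s \<in> S \<Longrightarrow> bar_d \<delta> (v s) = w s" by metis
    \<comment> \<open>Reattaching the tails to the primitives gives a chain whose boundary agrees
      with \<open>c\<close> modulo stage \<open>q\<close>.\<close>
    define b where "b xs = (\<Sum>s\<in>S. append_tail s (v s) xs)" for xs
    have avt: "supported (append_tail s (v s)) (tuples n (Suc k))" if "s \<in> S" for s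
      using tS[OF that v(1)[OF that]] m by simp
    have bt: "supported b (tuples n (Suc k))"
      unfolding b_def[abs_def] by (rule supported_sum) (rule avt)
    have db: "bar_d \<delta> b = (\<lambda>y. \<Sum>s\<in>S. bar_d \<delta> (append_tail s (v s)) y)"
      unfolding b_def[abs_def] by (rule bar_d_sum[OF finite_tuples avt])
    have "supported (\<lambda>y. \<Sum>s\<in>S. (bar_d \<delta> (append_tail s (v s)) y - append_tail s (bar_d \<delta> (v s)) y)) (tail_tuples n q k)"
    proof (rule supported_sum)
      fix s assume s: "s \<in> S"
      then show "supported (\<lambda>y. bar_d \<delta> (append_tail s (v s)) y - append_tail s (bar_d \<delta> (v s)) y) (tail_tuples n q k)"
        using bar_d_append_tail_remainder[OF v(1)[OF s], where s = s and k = k and \<delta> = \<delta>] m by (simp add: S_def)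
    qed
    then have "supported (\<lambda>y. c' y - (\<Sum>s\<in>S. (bar_d \<delta> (append_tail s (v s)) y - append_tail s (w s) y))) (tail_tuples n q k)"
      using supported_diff[OF c'] by (simp add: v(2) cong: sum.cong)
    moreover have "(\<lambda>y. c' y - (\<Sum>s\<in>S. (bar_d \<delta> (append_tail s (v s)) y - append_tail s (w s) y))) = (\<lambda>y. c y - bar_d \<delta> b y)"
      by (simp add: c'_def db sum_subtractf)
    ultimately have s2: "supported (\<lambda>y. c y - bar_d \<delta> b y) (tail_tuples n q k)" by simp
    have "bar_d \<delta> (\<lambda>y. c y - bar_d \<delta> b y) = (\<lambda>_. 0)"
      by (simp add: bar_d_diff[OF finite_tuples ct bar_d_tuples[OF bt]] bar_d_bar_d[OF bt] Suc.prems(2))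
    then obtain v' where v': "supported v' (tuples n (Suc k))" "bar_d \<delta> v' = (\<lambda>y. c y - bar_d \<delta> b y)"
      using Suc.IH[OF s2] by blast
    have "bar_d \<delta> (\<lambda>y. v' y + b y) = c"
      by (simp add: bar_d_add[OF finite_tuples v'(1) bt] v'(2))
    then show ?thesis using supported_add[OF v'(1) bt] by blast
  qed
qed

section \<open>The projection as a chain map\<close>

lemma face_coeff_perm:
  fixes \<delta> :: "'r::comm_ring_1"
  assumes "xs \<noteq> []" "i \<le> length xs" "set xs \<subseteq> diagrams n" "face_coeff \<delta> xs i \<noteq> 0"
  shows "set (face_list xs i) \<subseteq> perm_diagrams n \<longleftrightarrow> set xs \<subseteq> perm_diagrams n"
  using assms(1,2)
proof (cases rule: face_cases)
  case (first x ys)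
  \<comment> \<open>A nonzero augmentation forces the dropped entry to be a permutation.\<close>
  have "x \<in> perm_diagrams n"
    using assms(3,4) unfolding first by (simp add: face_0 eps_diagram[of _ n] split: if_splits)
  then show ?thesis unfolding first by (simp add: face_0)
next
  case (inner us x y vs)
  have "x \<in> diagrams n" "y \<in> diagrams n" using assms(3) unfolding inner(1) by auto
  then have "diag_comp x y \<in> perm_diagrams n \<longleftrightarrow> x \<in> perm_diagrams n \<and> y \<in> perm_diagrams n"
    by (rule diag_comp_perm_iff)
  moreover have "set xs = set us \<union> {x, y} \<union> set vs" unfolding inner(1) by auto
  ultimately show ?thesis unfolding face_inner(1)[OF inner] by auto
next
  case (last us x)
  have x: "x \<in> diagrams n" and e: "eps x \<noteq> (0 :: 'r)"
    using assms(3,4) face_last(2)[OF last, of \<delta>] unfolding last(1) by auto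
  then have "x \<in> perm_diagrams n" by (simp add: eps_diagram[of _ n] split: if_splits)
  moreover have "set xs = insert x (set us)" unfolding last(1) by auto
  ultimately show ?thesis unfolding face_last(1)[OF last] by simp
qed

text \<open>The differential has no nonzero entry between all-permutation tuples and the remaining
  ones, in either direction, so truncation commutes with it.\<close>

lemma bar_d_bar_pi:
  fixes \<delta> :: "'r::comm_ring_1"
  assumes c: "supported c (tuples n k)"
  shows "bar_d \<delta> (bar_pi n c) = bar_pi n (bar_d \<delta> c)"
proof
  fix ys
  have "supported (bar_pi n c) (tuples n k)" using c by (auto simp: supported_def bar_pi_def)
  then have "bar_d \<delta> (bar_pi n c) ys = (\<Sum>xs\<in>tuples n k. bar_pi n c xs * bar_d_basis \<delta> xs ys)"
    by (rule bar_d_eq[OF finite_tuples])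
  also have "\<dots> = (\<Sum>xs\<in>tuples n k. if set ys \<subseteq> perm_diagrams n then c xs * bar_d_basis \<delta> xs ys else 0)"
  proof (rule sum.cong[OF refl])
    fix xs assume "xs \<in> tuples n k"
    then have xs: "set xs \<subseteq> diagrams n" by (simp add: tuples_def)
    show "bar_pi n c xs * bar_d_basis \<delta> xs ys = (if set ys \<subseteq> perm_diagrams n then c xs * bar_d_basis \<delta> xs ys else 0)"
    proof (cases "bar_d_basis \<delta> xs ys = 0")
      case False
      then obtain i where "xs \<noteq> []" "i \<le> length xs" "ys = face_list xs i" "face_coeff \<delta> xs i \<noteq> 0"
        by (rule bar_d_basis_nonzeroE)
      then have "set ys \<subseteq> perm_diagrams n \<longleftrightarrow> set xs \<subseteq> perm_diagrams n"
        using face_coeff_perm[OF _ _ xs] by blast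
      then show ?thesis by (simp add: bar_pi_def)
    qed simp
  qed
  also have "\<dots> = bar_pi n (bar_d \<delta> c) ys"
    by (simp add: bar_pi_def bar_d_eq[OF finite_tuples c])
  finally show "bar_d \<delta> (bar_pi n c) ys = bar_pi n (bar_d \<delta> c) ys" .
qed

text \<open>Splitting at the last non-permutation entry leaves a tail of length below
  \<open>k\<close>, so stage \<open>k\<close> exhausts the kernel of the projection in degree
  \<open>k\<close>.\<close>

lemma nonperm_tuple_tail:
  assumes "xs \<in> tuples n k" "\<not> set xs \<subseteq> perm_diagrams n"
  shows "xs \<in> tail_tuples n k k"
proof -
  have xs: "set xs \<subseteq> diagrams n" "length xs = k" using assms(1) by (auto simp: tuples_def)
  obtain us z s where s: "xs = us @ z # s" "z \<notin> perm_diagrams n" "\<forall>y\<in>set s. \<not> y \<notin> perm_diagrams n"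
    using split_list_last_prop[of xs "\<lambda>x. x \<notin> perm_diagrams n"] assms(2) by blast
  have "xs = (us @ [z]) @ s" using s by simp
  then show ?thesis
    using assms(1) s xs tail_tuplesI[of "us @ [z]" s n k k] by auto
qed

text \<open>Homology is expressed through representatives: once both maps are known to preserve
  chains and commute with the differential, the last two clauses say that each composite changes a
  cycle only by a boundary, so the induced maps are mutually inverse.\<close>

theorem theoremA:
  fixes \<delta> :: "'r::comm_ring_1" and n k :: nat
  assumes "\<delta> dvd 1"
  shows "(\<forall>c\<in>(bar_chains (perm_diagrams n) k :: (int set set list \<Rightarrow> 'r) set). bar_iota c \<in> bar_chains (diagrams n) k)
    \<and> (\<forall>c\<in>(bar_chains (diagrams n) k :: (int set set list \<Rightarrow> 'r) set).
          bar_pi n c \<in> bar_chains (perm_diagrams n) k)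
    \<and> (\<forall>c\<in>bar_chains (perm_diagrams n) (Suc k). bar_d \<delta> (bar_iota c) = bar_iota (bar_d \<delta> c))
    \<and> (\<forall>c\<in>bar_chains (diagrams n) (Suc k). bar_d \<delta> (bar_pi n c) = bar_pi n (bar_d \<delta> c))
    \<and> (\<forall>z\<in>bar_cycles \<delta> (perm_diagrams n) k.
          (\<lambda>xs. bar_pi n (bar_iota z) xs - z xs) \<in> bar_boundaries \<delta> (perm_diagrams n) k)
    \<and> (\<forall>z\<in>bar_cycles \<delta> (diagrams n) k.
          (\<lambda>xs. bar_iota (bar_pi n z) xs - z xs) \<in> bar_boundaries \<delta> (diagrams n) k)"
proof (intro conjI ballI)
  fix c :: "int set set list \<Rightarrow> 'r"
  assume "c \<in> bar_chains (perm_diagrams n) k"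
  then show "bar_iota c \<in> bar_chains (diagrams n) k"
    using perm_diagrams_subset by (fastforce simp: bar_chains_def bar_iota_def)
next
  fix c :: "int set set list \<Rightarrow> 'r"
  assume "c \<in> bar_chains (diagrams n) k"
  then show "bar_pi n c \<in> bar_chains (perm_diagrams n) k"
    by (auto simp: bar_chains_def bar_pi_def split: if_splits)
next
  fix c :: "int set set list \<Rightarrow> 'r"
  show "bar_d \<delta> (bar_iota c) = bar_iota (bar_d \<delta> c)" by (simp add: bar_iota_def)
next
  fix c :: "int set set list \<Rightarrow> 'r"
  assume "c \<in> bar_chains (diagrams n) (Suc k)"
  then show "bar_d \<delta> (bar_pi n c) = bar_pi n (bar_d \<delta> c)"
    by (simp add: bar_chains_diagrams bar_d_bar_pi)
next
  fix z :: "int set set list \<Rightarrow> 'r"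
  assume z: "z \<in> bar_cycles \<delta> (perm_diagrams n) k"
  then have "\<And>xs. z xs \<noteq> 0 \<Longrightarrow> set xs \<subseteq> perm_diagrams n"
    by (auto simp: bar_cycles_def bar_chains_def)
  then have "bar_pi n (bar_iota z) xs - z xs = 0" for xs
    by (cases "z xs = 0") (simp_all add: bar_pi_def bar_iota_def)
  then have "(\<lambda>xs. bar_pi n (bar_iota z) xs - z xs) = bar_d \<delta> (\<lambda>_. 0)"
    by (simp add: bar_d_zero)
  moreover have "(\<lambda>_. 0) \<in> bar_chains (perm_diagrams n) (Suc k)" by (simp add: bar_chains_def)
  ultimately show "(\<lambda>xs. bar_pi n (bar_iota z) xs - z xs) \<in> bar_boundaries \<delta> (perm_diagrams n) k"
    unfolding bar_boundaries_def by (rule image_eqI)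
next
  fix z :: "int set set list \<Rightarrow> 'r"
  assume "z \<in> bar_cycles \<delta> (diagrams n) k"
  then have z: "supported z (tuples n k)" and cyc: "bar_d \<delta> z = (\<lambda>_. 0)"
    by (auto simp: bar_cycles_def bar_chains_diagrams)
  have p: "supported (bar_pi n z) (tuples n k)" using z by (auto simp: supported_def bar_pi_def)
  let ?c = "\<lambda>xs. bar_pi n z xs - z xs"
  \<comment> \<open>The difference is the part of -z on tuples with a non-permutation entry, hence
    in the kernel of the projection.\<close>
  have "supported ?c (tail_tuples n k k)"
    unfolding supported_def
  proof (intro allI impI)
    fix xs assume "?c xs \<noteq> 0"
    then have "z xs \<noteq> 0" "\<not> set xs \<subseteq> perm_diagrams n" by (auto simp: bar_pi_def split: if_splits)
    then show "xs \<in> tail_tuples n k k" using z nonperm_tuple_tail by (auto simp: supported_def)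
  qed
  moreover have "bar_d \<delta> ?c = (\<lambda>_. 0)"
    by (simp add: bar_d_diff[OF finite_tuples p z] bar_d_bar_pi[OF z] cyc) (simp add: bar_pi_def)
  ultimately obtain v where "supported v (tuples n (Suc k))" "bar_d \<delta> v = ?c"
    using acyclic_tail_tuples[OF assms] by blast
  then show "(\<lambda>xs. bar_iota (bar_pi n z) xs - z xs) \<in> bar_boundaries \<delta> (diagrams n) k"
    unfolding bar_boundaries_def bar_iota_def by (metis bar_chains_diagrams image_eqI)
qed

end
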